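(* For every $n\ge1$, the action of $\mathfrak{S}_{n+1}$ on $\operatorname{Perm}(n)$ given by the anticyclic structure of $\operatorname{Perm}$ is isomorphic to the representation by reflections of $\mathfrak{S}_{n+1}$, that is, the submodule with basis $\varepsilon_m-\varepsilon_{n+1}$ ($1\le m\le n$) of the permutation module with basis $\varepsilon_1,\dots,\varepsilon_{n+1}$.
   Context: All vector spaces are over $\mathbb{Q}$. The symmetric group $\mathfrak{S}_n$ acts on $\mathcal{P}(n)$ by $(\sigma\cdot E)(x_1,\dots,x_n)=E(x_{\sigma(1)},\dots,x_{\sigma(n)})$. An anticyclic operad is a symmetric operad $\mathcal{P}$ (unit $1\in\mathcal{P}(1)$, partial compositions $\circ_i$) together with an action of $\mathfrak{S}_{n+1}$ on each $\mathcal{P}(n)$ extending the action of $\mathfrak{S}_n$ (the stabilizer of $n+1$), such that, writing $\tau_n$ for the action of the long cycle $(n+1,n,\dots,2,1)$ ($1\mapsto n+1$, $i\mapsto i-1$ for $i\ge 2$): $\tau_1(1)=-1$ and, for $f\in\mathcal{P}(m)$, $g\in\mathcal{P}(n)$, $\tau(f\circ_i g)=\tau_m(f)\circ_{i-1}g$ for $2\le i\le m$ and $\tau(f\circ_1 g)=-\tau_n(g)\circ_n\tau_m(f)$. A morphism of anticyclic operads is a morphism of operads commuting with the actions of $\mathfrak{S}_{n+1}$. A non-symmetric anticyclic operad is a non-symmetric operad with endomorphisms $\tau_n$ of $\mathcal{P}(n)$ satisfying $\tau_n^{n+1}=\mathrm{Id}$ and these same identities. If $\mathcal{P}$ is a non-symmetric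 anticyclic operad, the symmetric operad with components $\mathcal{P}(n)\otimes\mathbb{Q}\mathfrak{S}_n\cong\operatorname{Ind}_{\mathbb{Z}/(n+1)\mathbb{Z}}^{\mathfrak{S}_{n+1}}\mathcal{P}(n)$ is naturally an anticyclic operad, with $\tau_n(E\otimes 1)=\tau_n(E)\otimes 1$. The non-symmetric operad $\operatorname{Dias}$ is generated by binary operations $x\dashv y$, $x\vdash y$ with relations $x\dashv(y\vdash z)=x\dashv(y\dashv z)=(x\dashv y)\dashv z$, $x\vdash(y\dashv z)=(x\vdash y)\dashv z$, $x\vdash(y\vdash z)=(x\vdash y)\vdash z=(x\dashv y)\vdash z$. It is a non-symmetric anticyclic operad with the unique structure such that $\tau_1=-\mathrm{Id}$, $\tau_2(x_1\dashv x_2)=-x_1\vdash x_2$, $\tau_2(x_1\vdash x_2)=x_1\dashv x_2-x_1\vdash x_2$. We also write $\operatorname{Dias}$ for the associated (symmetric) anticyclic operad. $\operatorname{Perm}$ is the quotient of the symmetric operad $\operatorname{Dias}$ by the ideal generated by $x_1\dashv x_2-x_2\vdash x_1$; denoting by $x_1x_2$ the image of $x_1\dashv x_2$, it is generated by the binary product $xy$ with relations $(xy)z=x(yz)=x(zy)$. It carries the unique anticyclic operad structure for which the quotient map from $\operatorname{Dias}$ is a morphism of anticyclic operads. *)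

theory Defs
  imports
    "HOL.Rat"
    "HOL-Algebra.Module"
    "HOL-Algebra.AbelCoset"
    "HOL-Algebra.Sym_Groups"
    "HOL-Combinatorics.Transposition"
    "HOL-Library.Poly_Mapping"
    "HOL-Library.Tree"
begin

section \<open>Rational vector spaces and representations\<close>

definition rat_ring :: "rat ring" where
  "rat_ring = \<lparr>carrier = UNIV, monoid.mult = (*), one = 1, zero = 0, add = (+)\<rparr>"

text \<open>A rational vector space is a \<^const>\<open>module\<close> over \<^const>\<open>rat_ring\<close>. The record type of modules
  extends that of rings, so it has fields \<^const>\<open>monoid.mult\<close> and \<^const>\<open>one\<close>; they play no role and are left
  unspecified throughout.\<close>

definition linear_maps ::
  "(rat, 'a, 'm) module_scheme \<Rightarrow> (rat, 'b, 'n) module_scheme \<Rightarrow> ('a \<Rightarrow> 'b) set" where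
  "linear_maps V W = {f \<in> carrier V \<rightarrow> carrier W.
     (\<forall>x\<in>carrier V. \<forall>y\<in>carrier V. f (x \<oplus>\<^bsub>V\<^esub> y) = f x \<oplus>\<^bsub>W\<^esub> f y) \<and>
     (\<forall>a. \<forall>x\<in>carrier V. f (a \<odot>\<^bsub>V\<^esub> x) = a \<odot>\<^bsub>W\<^esub> f x)}"

definition quot_module ::
  "(rat, 'a, 'm) module_scheme \<Rightarrow> 'a set \<Rightarrow> (rat, 'a set) module" where
  "quot_module V H =
     \<lparr>carrier = a_rcosets\<^bsub>V\<^esub> H, monoid.mult = undefined, one = undefined, zero = H, add = set_add V,
      smult = (\<lambda>a X. \<Union>x\<in>X. H +>\<^bsub>V\<^esub> (a \<odot>\<^bsub>V\<^esub> x))\<rparr>"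

text \<open>The vector space with basis a given set.\<close>

definition free_module :: "'a set \<Rightarrow> (rat, 'a \<Rightarrow>\<^sub>0 rat) module" where
  "free_module B =
     \<lparr>carrier = {v. Poly_Mapping.keys v \<subseteq> B}, monoid.mult = undefined, one = undefined, zero = 0, add = (+),
      smult = (\<lambda>a. Poly_Mapping.map ((*) a))\<rparr>"

abbreviation basis_vec :: "'a \<Rightarrow> ('a \<Rightarrow>\<^sub>0 rat)" where
  "basis_vec b \<equiv> Poly_Mapping.single b 1"

definition linear_rep ::
  "('g, 'k) monoid_scheme \<Rightarrow> (rat, 'a, 'm) module_scheme \<Rightarrow> ('g \<Rightarrow> 'a \<Rightarrow> 'a) \<Rightarrow> bool" where
  "linear_rep G V \<rho> \<longleftrightarrow>
     (\<forall>g\<in>carrier G. \<rho> g \<in> linear_maps V V) \<and>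
     (\<forall>x\<in>carrier V. \<rho> \<one>\<^bsub>G\<^esub> x = x) \<and>
     (\<forall>g\<in>carrier G. \<forall>h\<in>carrier G. \<forall>x\<in>carrier V. \<rho> (g \<otimes>\<^bsub>G\<^esub> h) x = \<rho> g (\<rho> h x))"

definition isomorphic_reps ::
  "('g, 'k) monoid_scheme \<Rightarrow> (rat, 'a, 'm) module_scheme \<Rightarrow> ('g \<Rightarrow> 'a \<Rightarrow> 'a) \<Rightarrow>
   (rat, 'b, 'n) module_scheme \<Rightarrow> ('g \<Rightarrow> 'b \<Rightarrow> 'b) \<Rightarrow> bool" where
  "isomorphic_reps G V \<rho> W \<rho>' \<longleftrightarrow>
     linear_rep G V \<rho> \<and> linear_rep G W \<rho>' \<and>
     (\<exists>\<phi>\<in>linear_maps V W. bij_betw \<phi> (carrier V) (carrier W) \<and>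
        (\<forall>g\<in>carrier G. \<forall>x\<in>carrier V. \<phi> (\<rho> g x) = \<rho>' g (\<phi> x)))"


section \<open>Operads\<close>

text \<open>Operads have components in arities \<open>n \<ge> 1\<close> only; the component with index \<open>0\<close> is never constrained.
  The operation \<open>pcomp P m n i f g\<close> is the partial composition \<open>f \<circ>\<^sub>i g\<close> of
  \<open>f \<in> P(m)\<close> and \<open>g \<in> P(n)\<close>.\<close>

record 'a nsoperad =
  comps :: "nat \<Rightarrow> (rat, 'a) module"
  ounit :: 'a
  pcomp :: "nat \<Rightarrow> nat \<Rightarrow> nat \<Rightarrow> 'a \<Rightarrow> 'a \<Rightarrow> 'a"

record 'a operad = "'a nsoperad" +
  sact :: "nat \<Rightarrow> (nat \<Rightarrow> nat) \<Rightarrow> 'a \<Rightarrow> 'a"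

locale ns_operad =
  fixes P :: "('a, 'k) nsoperad_scheme"
  assumes comps_module: "1 \<le> n \<Longrightarrow> module rat_ring (comps P n)"
    and unit_closed: "ounit P \<in> carrier (comps P 1)"
    and pcomp_linear_left:
      "\<lbrakk>1 \<le> i; i \<le> m; 1 \<le> n; g \<in> carrier (comps P n)\<rbrakk> \<Longrightarrow>
       (\<lambda>f. pcomp P m n i f g) \<in> linear_maps (comps P m) (comps P (m + n - 1))"
    and pcomp_linear_right:
      "\<lbrakk>1 \<le> i; i \<le> m; 1 \<le> n; f \<in> carrier (comps P m)\<rbrakk> \<Longrightarrow>
       pcomp P m n i f \<in> linear_maps (comps P n) (comps P (m + n - 1))"
    and unit_left: "\<lbrakk>1 \<le> n; f \<in> carrier (comps P n)\<rbrakk> \<Longrightarrow> pcomp P 1 n 1 (ounit P) f = f"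
    and unit_right: "\<lbrakk>1 \<le> i; i \<le> n; f \<in> carrier (comps P n)\<rbrakk> \<Longrightarrow> pcomp P n 1 i f (ounit P) = f"
    and pcomp_nested:
      "\<lbrakk>1 \<le> i; i \<le> l; 1 \<le> j; j \<le> m; 1 \<le> n;
        f \<in> carrier (comps P l); g \<in> carrier (comps P m); h \<in> carrier (comps P n)\<rbrakk> \<Longrightarrow>
       pcomp P (l + m - 1) n (i + j - 1) (pcomp P l m i f g) h =
       pcomp P l (m + n - 1) i f (pcomp P m n j g h)"
    and pcomp_parallel:
      "\<lbrakk>1 \<le> i; i < k; k \<le> l; 1 \<le> m; 1 \<le> n;
        f \<in> carrier (comps P l); g \<in> carrier (comps P m); h \<in> carrier (comps P n)\<rbrakk> \<Longrightarrow>
       pcomp P (l + m - 1) n (k + m - 1) (pcomp P l m i f g) h =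
       pcomp P (l + n - 1) m i (pcomp P l n k f h) g"

text \<open>Read a permutation \<open>\<sigma>\<close> of \<open>{1..m}\<close> as the word \<open>\<sigma>(1)\<dots>\<sigma>(m)\<close>, i.e. as the monomial
  \<open>x\<^bsub>\<sigma>(1)\<^esub>\<dots>x\<^bsub>\<sigma>(m)\<^esub>\<close>. Then \<open>perm_pcomp m n i \<sigma> \<rho>\<close> substitutes the word of \<open>\<rho>\<close>, a permutation
  of \<open>{1..n}\<close>, for the letter \<open>i\<close>: the letters of \<open>\<rho>\<close> are raised by \<open>i - 1\<close> and the letters
  of \<open>\<sigma>\<close> above \<open>i\<close> by \<open>n - 1\<close>. The letter \<open>i\<close> is found in position \<open>inv \<sigma> i\<close>.\<close>

definition perm_pcomp ::
  "nat \<Rightarrow> nat \<Rightarrow> nat \<Rightarrow> (nat \<Rightarrow> nat) \<Rightarrow> (nat \<Rightarrow> nat) \<Rightarrow> nat \<Rightarrow> nat" where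
  "perm_pcomp m n i \<sigma> \<rho> k =
     (let p = inv' \<sigma> i; shift = (\<lambda>a. if a < i then a else a + n - 1) in
      if k \<notin> {1..m + n - 1} then k
      else if k < p then shift (\<sigma> k)
      else if k < p + n then \<rho> (k + 1 - p) + i - 1
      else shift (\<sigma> (k + 1 - n)))"

text \<open>The left action of the symmetric group is \<open>(\<sigma> \<cdot> E)(x\<^sub>1,\<dots>,x\<^sub>n) = E(x\<^bsub>\<sigma>(1)\<^esub>,\<dots>,x\<^bsub>\<sigma>(n)\<^esub>)\<close>. Hence the
  variable \<open>x\<^sub>i\<close> of \<open>\<sigma> \<cdot> f\<close> sits in the input \<open>inv \<sigma> i\<close> of \<open>f\<close>.\<close>

locale symmetric_operad = ns_operad P for P :: "('a, 'k) operad_scheme" +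
  assumes sact_rep: "1 \<le> n \<Longrightarrow> linear_rep (sym_group n) (comps P n) (sact P n)"
    and sact_equivariant:
      "\<lbrakk>1 \<le> i; i \<le> m; 1 \<le> n; \<sigma> permutes {1..m}; \<rho> permutes {1..n};
        f \<in> carrier (comps P m); g \<in> carrier (comps P n)\<rbrakk> \<Longrightarrow>
       pcomp P m n i (sact P m \<sigma> f) (sact P n \<rho> g) =
       sact P (m + n - 1) (perm_pcomp m n i \<sigma> \<rho>) (pcomp P m n (inv' \<sigma> i) f g)"

definition operad_morphism ::
  "('a, 'k) operad_scheme \<Rightarrow> ('b, 'l) operad_scheme \<Rightarrow> (nat \<Rightarrow> 'a \<Rightarrow> 'b) \<Rightarrow> bool" where
  "operad_morphism P Q \<phi> \<longleftrightarrow>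
     (\<forall>n\<ge>1. \<phi> n \<in> linear_maps (comps P n) (comps Q n)) \<and>
     \<phi> 1 (ounit P) = ounit Q \<and>
     (\<forall>m\<ge>1. \<forall>n\<ge>1. \<forall>i\<in>{1..m}. \<forall>f\<in>carrier (comps P m). \<forall>g\<in>carrier (comps P n).
        \<phi> (m + n - 1) (pcomp P m n i f g) = pcomp Q m n i (\<phi> m f) (\<phi> n g)) \<and>
     (\<forall>n\<ge>1. \<forall>\<sigma>. \<sigma> permutes {1..n} \<longrightarrow>
        (\<forall>f\<in>carrier (comps P n). \<phi> n (sact P n \<sigma> f) = sact Q n \<sigma> (\<phi> n f)))"


section \<open>Ideals and quotients\<close>

definition ns_ideal :: "('a, 'k) nsoperad_scheme \<Rightarrow> (nat \<Rightarrow> 'a set) \<Rightarrow> bool" where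
  "ns_ideal P I \<longleftrightarrow>
     (\<forall>n\<ge>1. submodule (I n) rat_ring (comps P n)) \<and>
     (\<forall>m\<ge>1. \<forall>n\<ge>1. \<forall>i\<in>{1..m}. \<forall>f\<in>carrier (comps P m). \<forall>g\<in>carrier (comps P n).
        f \<in> I m \<or> g \<in> I n \<longrightarrow> pcomp P m n i f g \<in> I (m + n - 1))"

definition operad_ideal :: "('a, 'k) operad_scheme \<Rightarrow> (nat \<Rightarrow> 'a set) \<Rightarrow> bool" where
  "operad_ideal P I \<longleftrightarrow> ns_ideal P I \<and>
     (\<forall>n\<ge>1. \<forall>\<sigma>. \<sigma> permutes {1..n} \<longrightarrow> sact P n \<sigma> ` I n \<subseteq> I n)"

definition ns_ideal_gen ::
  "('a, 'k) nsoperad_scheme \<Rightarrow> (nat \<Rightarrow> 'a set) \<Rightarrow> nat \<Rightarrow> 'a set" where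
  "ns_ideal_gen P R n = \<Inter> {I n | I. ns_ideal P I \<and> (\<forall>k\<ge>1. R k \<subseteq> I k)}"

definition operad_ideal_gen ::
  "('a, 'k) operad_scheme \<Rightarrow> (nat \<Rightarrow> 'a set) \<Rightarrow> nat \<Rightarrow> 'a set" where
  "operad_ideal_gen P R n = \<Inter> {I n | I. operad_ideal P I \<and> (\<forall>k\<ge>1. R k \<subseteq> I k)}"

definition quot_proj ::
  "('a, 'k) nsoperad_scheme \<Rightarrow> (nat \<Rightarrow> 'a set) \<Rightarrow> nat \<Rightarrow> 'a \<Rightarrow> 'a set" where
  "quot_proj P I n x = I n +>\<^bsub>comps P n\<^esub> x"

definition quot_nsoperad ::
  "('a, 'k) nsoperad_scheme \<Rightarrow> (nat \<Rightarrow> 'a set) \<Rightarrow> 'a set nsoperad" where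
  "quot_nsoperad P I =
     \<lparr>comps = (\<lambda>n. quot_module (comps P n) (I n)),
      ounit = quot_proj P I 1 (ounit P),
      pcomp = (\<lambda>m n i X Y. \<Union>x\<in>X. \<Union>y\<in>Y. quot_proj P I (m + n - 1) (pcomp P m n i x y))\<rparr>"

definition quot_operad ::
  "('a, 'k) operad_scheme \<Rightarrow> (nat \<Rightarrow> 'a set) \<Rightarrow> 'a set operad" where
  "quot_operad P I =
     \<lparr>comps = comps (quot_nsoperad P I),
      ounit = ounit (quot_nsoperad P I),
      pcomp = pcomp (quot_nsoperad P I),
      sact = (\<lambda>n \<sigma> X. \<Union>x\<in>X. quot_proj P I n (sact P n \<sigma> x))\<rparr>"


section \<open>Anticyclic operads\<close>

text \<open>The long cycle \<open>1 \<mapsto> n + 1\<close>, \<open>i \<mapsto> i - 1\<close>.\<close>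

definition long_cycle :: "nat \<Rightarrow> nat \<Rightarrow> nat" where
  "long_cycle n i = (if i = 1 then n + 1 else if i \<in> {2..n + 1} then i - 1 else i)"

definition anticyclic_identities ::
  "('a, 'k) nsoperad_scheme \<Rightarrow> (nat \<Rightarrow> 'a \<Rightarrow> 'a) \<Rightarrow> bool" where
  "anticyclic_identities P \<tau> \<longleftrightarrow>
     \<tau> 1 (ounit P) = \<ominus>\<^bsub>comps P 1\<^esub> ounit P \<and>
     (\<forall>m\<ge>1. \<forall>n\<ge>1. \<forall>f\<in>carrier (comps P m). \<forall>g\<in>carrier (comps P n).
        (\<forall>i\<in>{2..m}. \<tau> (m + n - 1) (pcomp P m n i f g) = pcomp P m n (i - 1) (\<tau> m f) g) \<and>
        \<tau> (m + n - 1) (pcomp P m n 1 f g) =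
          \<ominus>\<^bsub>comps P (m + n - 1)\<^esub> pcomp P n m n (\<tau> n g) (\<tau> m f))"

locale anticyclic_operad = symmetric_operad P
  for P :: "('a, 'k) operad_scheme" and \<rho> :: "nat \<Rightarrow> (nat \<Rightarrow> nat) \<Rightarrow> 'a \<Rightarrow> 'a" +
  assumes rep: "1 \<le> n \<Longrightarrow> linear_rep (sym_group (n + 1)) (comps P n) (\<rho> n)"
    and extends_sact:
      "\<lbrakk>1 \<le> n; \<sigma> permutes {1..n}; f \<in> carrier (comps P n)\<rbrakk> \<Longrightarrow> \<rho> n \<sigma> f = sact P n \<sigma> f"
    and identities: "anticyclic_identities P (\<lambda>n. \<rho> n (long_cycle n))"

definition anticyclic_morphism ::
  "('a, 'k) operad_scheme \<Rightarrow> (nat \<Rightarrow> (nat \<Rightarrow> nat) \<Rightarrow> 'a \<Rightarrow> 'a) \<Rightarrow>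
   ('b, 'l) operad_scheme \<Rightarrow> (nat \<Rightarrow> (nat \<Rightarrow> nat) \<Rightarrow> 'b \<Rightarrow> 'b) \<Rightarrow> (nat \<Rightarrow> 'a \<Rightarrow> 'b) \<Rightarrow> bool" where
  "anticyclic_morphism P \<rho> Q \<rho>' \<phi> \<longleftrightarrow> operad_morphism P Q \<phi> \<and>
     (\<forall>n\<ge>1. \<forall>g. g permutes {1..n + 1} \<longrightarrow>
        (\<forall>f\<in>carrier (comps P n). \<phi> n (\<rho> n g f) = \<rho>' n g (\<phi> n f)))"

locale ns_anticyclic_operad = ns_operad P
  for P :: "('a, 'k) nsoperad_scheme" and \<tau> :: "nat \<Rightarrow> 'a \<Rightarrow> 'a" +
  assumes \<tau>_linear: "1 \<le> n \<Longrightarrow> \<tau> n \<in> linear_maps (comps P n) (comps P n)"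
    and \<tau>_order: "\<lbrakk>1 \<le> n; f \<in> carrier (comps P n)\<rbrakk> \<Longrightarrow> (\<tau> n ^^ (n + 1)) f = f"
    and identities: "anticyclic_identities P \<tau>"


section \<open>Symmetrization\<close>

text \<open>An element \<open>\<Sum>\<^sub>s E\<^sub>s \<otimes> s\<close> of the tensor product of \<open>P(n)\<close> with the group algebra of the symmetric group
  is represented by the function \<open>s \<mapsto> E\<^sub>s\<close> on permutations, and \<open>E \<otimes> s\<close> stands for the operation
  \<open>E(x\<^bsub>s(1)\<^esub>,\<dots>,x\<^bsub>s(n)\<^esub>)\<close>.\<close>

abbreviation perms :: "nat \<Rightarrow> (nat \<Rightarrow> nat) set" where
  "perms n \<equiv> {s. s permutes {1..n}}"

definition pure_tensor ::
  "('a, 'k) nsoperad_scheme \<Rightarrow> nat \<Rightarrow> 'a \<Rightarrow> (nat \<Rightarrow> nat) \<Rightarrow> (nat \<Rightarrow> nat) \<Rightarrow> 'a" where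
  "pure_tensor P n E s = (\<lambda>t\<in>perms n. if t = s then E else \<zero>\<^bsub>comps P n\<^esub>)"

definition symmetrization :: "('a, 'k) nsoperad_scheme \<Rightarrow> ((nat \<Rightarrow> nat) \<Rightarrow> 'a) operad" where
  "symmetrization P =
     \<lparr>comps = (\<lambda>n.
        \<lparr>carrier = perms n \<rightarrow>\<^sub>E carrier (comps P n), monoid.mult = undefined, one = undefined,
         zero = (\<lambda>s\<in>perms n. \<zero>\<^bsub>comps P n\<^esub>),
         add = (\<lambda>u v. \<lambda>s\<in>perms n. u s \<oplus>\<^bsub>comps P n\<^esub> v s),
         smult = (\<lambda>a u. \<lambda>s\<in>perms n. a \<odot>\<^bsub>comps P n\<^esub> u s)\<rparr>),
      ounit = pure_tensor P 1 (ounit P) id,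
      pcomp = (\<lambda>m n i u v. \<lambda>\<pi>\<in>perms (m + n - 1).
        finsum (comps P (m + n - 1)) (\<lambda>(s, t). pcomp P m n (inv' s i) (u s) (v t))
          {(s, t) \<in> perms m \<times> perms n. perm_pcomp m n i s t = \<pi>}),
      sact = (\<lambda>n \<sigma> u. \<lambda>s\<in>perms n. u (inv' \<sigma> \<circ> s))\<rparr>"

text \<open>The action induced from the cyclic group generated by \<open>c = long_cycle n\<close>: for \<open>g\<close> in the symmetric
  group on \<open>{1..n + 1}\<close> and \<open>s\<close> in the one on \<open>{1..n}\<close>, write \<open>g s = t c\<^sup>k\<close> uniquely with \<open>t\<close> fixing
  \<open>n + 1\<close> and \<open>k \<le> n\<close>; then \<open>g \<cdot> (E \<otimes> s) = \<tau>\<^sup>k(E) \<otimes> t\<close>. Taking \<open>g = c\<close> and \<open>s = id\<close>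
  gives \<open>\<tau>(E \<otimes> 1) = \<tau>(E) \<otimes> 1\<close>.\<close>

definition symmetrization_action ::
  "('a, 'k) nsoperad_scheme \<Rightarrow> (nat \<Rightarrow> 'a \<Rightarrow> 'a) \<Rightarrow>
   nat \<Rightarrow> (nat \<Rightarrow> nat) \<Rightarrow> ((nat \<Rightarrow> nat) \<Rightarrow> 'a) \<Rightarrow> (nat \<Rightarrow> nat) \<Rightarrow> 'a" where
  "symmetrization_action P \<tau> n g u = (\<lambda>t\<in>perms n.
     finsum (comps P n) (\<lambda>(s, k). (\<tau> n ^^ k) (u s))
       {(s, k) \<in> perms n \<times> {0..n}. g \<circ> s = t \<circ> (long_cycle n ^^ k)})"


section \<open>The operads Dias and Perm\<close>

text \<open>A basis of the free non-symmetric operad on a set of binary operations is given by the planar binary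
  trees whose inner nodes are labelled by operations. The inputs are the leaves, numbered from left to
  right starting with \<open>1\<close>; their number is \<^const>\<open>size1\<close>.\<close>

fun graft :: "nat \<Rightarrow> 'g tree \<Rightarrow> 'g tree \<Rightarrow> 'g tree" where
  "graft i Leaf s = s"
| "graft i (Node l x r) s =
     (if i \<le> size1 l then Node (graft i l s) x r else Node l x (graft (i - size1 l) r s))"

definition free_nsoperad :: "('g tree \<Rightarrow>\<^sub>0 rat) nsoperad" where
  "free_nsoperad =
     \<lparr>comps = (\<lambda>n. free_module {t. size1 t = n}),
      ounit = basis_vec Leaf,
      pcomp = (\<lambda>m n i f g. \<Sum>t\<in>Poly_Mapping.keys f. \<Sum>s\<in>Poly_Mapping.keys g.
        Poly_Mapping.single (graft i t s) (Poly_Mapping.lookup f t * Poly_Mapping.lookup g s))\<rparr>"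

datatype dias_op = LeftProd (\<open>\<stileturn>\<close>) | RightProd (\<open>\<turnstile>\<close>)

abbreviation lcomb :: "'g \<Rightarrow> 'g \<Rightarrow> ('g tree \<Rightarrow>\<^sub>0 rat)" where \<comment> \<open>\<open>(x a y) b z\<close>\<close>
  "lcomb a b \<equiv> basis_vec \<langle>\<langle>\<langle>\<rangle>, a, \<langle>\<rangle>\<rangle>, b, \<langle>\<rangle>\<rangle>"

abbreviation rcomb :: "'g \<Rightarrow> 'g \<Rightarrow> ('g tree \<Rightarrow>\<^sub>0 rat)" where \<comment> \<open>\<open>x a (y b z)\<close>\<close>
  "rcomb a b \<equiv> basis_vec \<langle>\<langle>\<rangle>, a, \<langle>\<langle>\<rangle>, b, \<langle>\<rangle>\<rangle>\<rangle>"

definition dias_relations :: "nat \<Rightarrow> (dias_op tree \<Rightarrow>\<^sub>0 rat) set" where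
  "dias_relations n = (if n = 3 then
     {rcomb \<stileturn> \<turnstile> - rcomb \<stileturn> \<stileturn>,
      rcomb \<stileturn> \<stileturn> - lcomb \<stileturn> \<stileturn>,
      rcomb \<turnstile> \<stileturn> - lcomb \<turnstile> \<stileturn>,
      rcomb \<turnstile> \<turnstile> - lcomb \<turnstile> \<turnstile>,
      lcomb \<turnstile> \<turnstile> - lcomb \<stileturn> \<turnstile>} else {})"

definition dias_ideal :: "nat \<Rightarrow> (dias_op tree \<Rightarrow>\<^sub>0 rat) set" where
  "dias_ideal = ns_ideal_gen free_nsoperad dias_relations"

definition Dias :: "(dias_op tree \<Rightarrow>\<^sub>0 rat) set nsoperad" where
  "Dias = quot_nsoperad free_nsoperad dias_ideal"

definition dias_gen :: "dias_op \<Rightarrow> (dias_op tree \<Rightarrow>\<^sub>0 rat) set" where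
  "dias_gen a = quot_proj free_nsoperad dias_ideal 2 (basis_vec \<langle>\<langle>\<rangle>, a, \<langle>\<rangle>\<rangle>)"

definition dias_anticyclic ::
  "(nat \<Rightarrow> (dias_op tree \<Rightarrow>\<^sub>0 rat) set \<Rightarrow> (dias_op tree \<Rightarrow>\<^sub>0 rat) set) \<Rightarrow> bool" where
  "dias_anticyclic \<tau> \<longleftrightarrow> ns_anticyclic_operad Dias \<tau> \<and>
     (\<forall>f\<in>carrier (comps Dias 1). \<tau> 1 f = \<ominus>\<^bsub>comps Dias 1\<^esub> f) \<and>
     \<tau> 2 (dias_gen \<stileturn>) = \<ominus>\<^bsub>comps Dias 2\<^esub> dias_gen \<turnstile> \<and>
     \<tau> 2 (dias_gen \<turnstile>) = dias_gen \<stileturn> \<ominus>\<^bsub>comps Dias 2\<^esub> dias_gen \<turnstile>"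

abbreviation SymDias :: "((nat \<Rightarrow> nat) \<Rightarrow> (dias_op tree \<Rightarrow>\<^sub>0 rat) set) operad" where
  "SymDias \<equiv> symmetrization Dias"

text \<open>The relation \<open>x\<^sub>1 \<stileturn> x\<^sub>2 - x\<^sub>2 \<turnstile> x\<^sub>1\<close>.\<close>

definition perm_relations :: "nat \<Rightarrow> ((nat \<Rightarrow> nat) \<Rightarrow> (dias_op tree \<Rightarrow>\<^sub>0 rat) set) set" where
  "perm_relations n = (if n = 2 then
     {pure_tensor Dias 2 (dias_gen \<stileturn>) id \<ominus>\<^bsub>comps SymDias 2\<^esub>
      pure_tensor Dias 2 (dias_gen \<turnstile>) (transpose 1 2)} else {})"

definition perm_ideal :: "nat \<Rightarrow> ((nat \<Rightarrow> nat) \<Rightarrow> (dias_op tree \<Rightarrow>\<^sub>0 rat) set) set" where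
  "perm_ideal = operad_ideal_gen SymDias perm_relations"

definition Perm :: "((nat \<Rightarrow> nat) \<Rightarrow> (dias_op tree \<Rightarrow>\<^sub>0 rat) set) set operad" where
  "Perm = quot_operad SymDias perm_ideal"

text \<open>\<open>perm_anticyclic \<tau> \<rho>\<close>: the family \<open>\<rho>\<close> is the anticyclic structure of \<^const>\<open>Perm\<close> induced from the
  structure \<open>\<tau>\<close> on \<^const>\<open>Dias\<close>.\<close>

definition perm_anticyclic ::
  "(nat \<Rightarrow> (dias_op tree \<Rightarrow>\<^sub>0 rat) set \<Rightarrow> (dias_op tree \<Rightarrow>\<^sub>0 rat) set) \<Rightarrow>
   (nat \<Rightarrow> (nat \<Rightarrow> nat) \<Rightarrow> ((nat \<Rightarrow> nat) \<Rightarrow> (dias_op tree \<Rightarrow>\<^sub>0 rat) set) set \<Rightarrow>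
    ((nat \<Rightarrow> nat) \<Rightarrow> (dias_op tree \<Rightarrow>\<^sub>0 rat) set) set) \<Rightarrow> bool" where
  "perm_anticyclic \<tau> \<rho> \<longleftrightarrow> anticyclic_operad Perm \<rho> \<and>
     anticyclic_morphism SymDias (symmetrization_action Dias \<tau>) Perm \<rho> (quot_proj SymDias perm_ideal)"


section \<open>The reflection representation\<close>

definition permutation_action :: "('a \<Rightarrow> 'a) \<Rightarrow> ('a \<Rightarrow>\<^sub>0 rat) \<Rightarrow> ('a \<Rightarrow>\<^sub>0 rat)" where
  "permutation_action g v =
     (\<Sum>i\<in>Poly_Mapping.keys v. Poly_Mapping.single (g i) (Poly_Mapping.lookup v i))"

text \<open>The subspace of the vector space with basis \<open>\<epsilon>\<^sub>1, \<dots>, \<epsilon>\<^bsub>n+1\<^esub>\<close> spanned by the vectors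
  \<open>\<epsilon>\<^sub>m - \<epsilon>\<^bsub>n+1\<^esub>\<close>.\<close>

definition reflection_module :: "nat \<Rightarrow> (rat, nat \<Rightarrow>\<^sub>0 rat) module" where
  "reflection_module n = (free_module {1..n + 1})
     \<lparr>carrier := {\<Sum>m = 1..n. Poly_Mapping.map ((*) (a m)) (basis_vec m - basis_vec (n + 1)) | a. True}\<rparr>"

end

theory Submission
  imports Defs
begin

text \<open>
  A monomial in the operations \<open>\<stileturn>\<close> and \<open>\<turnstile>\<close> has a head: the input reached from the root by
  always walking in the direction in which the horizontal stroke of the operation points. The relations of Dias identify two monomials of the same arity exactly
  if they have the same head. One direction holds because the head of a composite depends only on
  the heads of its factors, so that the functionals of the head cut out an ideal containing the
  relations; the other one is a normal form argument (\<open>dias_ideal_eq\<close>). Thus \<open>Dias(n)\<close> has a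
  basis \<open>e\<^sub>1, \<dots>, e\<^sub>n\<close>.

  In the symmetrization the variable \<open>x\<^bsub>s p\<^esub>\<close> is in the head of \<open>e\<^sub>p \<otimes> s\<close>, and this variable is all that Perm
  retains (\<open>perm_ideal_eq\<close>). Again the functionals of the head variable cut out an operadic ideal
  containing the relation. Conversely, composing the relation with monomials shows that, modulo the
  ideal, two neighbouring variables may be interchanged as long as the variable in the head stays the
  same; hence the order of the variables may be changed arbitrarily under this condition. So
  \<open>Perm(n)\<close> has a basis indexed by the variables, permuted by the symmetric group on \<open>n\<close> letters.

  Every monomial of arity \<open>n \<ge> 2\<close> is of the form \<open>g \<circ>\<^sub>2 G\<close> in Dias, with a generator \<open>g\<close>. The identity
  \<open>\<tau>(g \<circ>\<^sub>2 G) = \<tau>(g) \<circ>\<^sub>1 G\<close> therefore gives \<open>\<tau> e\<^sub>1 = - e\<^sub>n\<close> and \<open>\<tau> e\<^sub>p = e\<^bsub>p-1\<^esub> - e\<^sub>n\<close> for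
  \<open>p \<ge> 2\<close>, which is how the long cycle acts on the vectors \<open>\<epsilon>\<^sub>p - \<epsilon>\<^bsub>n+1\<^esub>\<close>
  (\<open>dias_anticyclic_pairing\<close>). Consequently the map taking a monomial with head variable \<open>x\<^sub>m\<close> to
  \<open>\<epsilon>\<^sub>m - \<epsilon>\<^bsub>n+1\<^esub>\<close> is equivariant (\<open>reduced_pairing_action\<close>); it is bijective by the description of
  \<open>Perm(n)\<close>.

  Throughout, an element is represented not by coordinates but by its pairings with arbitrary test
  functions \<open>F\<close> of the head: a monomial with head \<open>p\<close> is paired to \<open>F p\<close>. The free
  operad, Dias and the symmetrization of Dias all carry such a pairing (\<open>head_pairing\<close>), and the ideals
  that define Dias and Perm are the annihilators of the first and the last of these.
\<close>

section \<open>Linear extension of functions on a basis\<close>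

text \<open>The arity of a composition has the form \<open>m + n - 1\<close>; the subtrahend has to keep this shape for facts
  about compositions to apply.\<close>

declare One_nat_def [simp del]

lemma rat_ring_simps [simp]:
  "carrier rat_ring = UNIV" "x \<otimes>\<^bsub>rat_ring\<^esub> y = x * y" "\<one>\<^bsub>rat_ring\<^esub> = 1"
  "\<zero>\<^bsub>rat_ring\<^esub> = 0" "x \<oplus>\<^bsub>rat_ring\<^esub> y = x + y"
  by (simp_all add: rat_ring_def)

lemma cring_rat_ring: "cring rat_ring"
proof (rule cringI)
  show "abelian_group rat_ring"
  proof (rule abelian_groupI)
    show "\<exists>y\<in>carrier rat_ring. y \<oplus>\<^bsub>rat_ring\<^esub> x = \<zero>\<^bsub>rat_ring\<^esub>" for x
      by (rule bexI[of _ "- x"]) simp_all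
  qed simp_all
  show "comm_monoid rat_ring"
    by (rule comm_monoidI) simp_all
qed (simp_all add: distrib_right)

definition linext :: "('a \<Rightarrow> rat) \<Rightarrow> ('a \<Rightarrow>\<^sub>0 rat) \<Rightarrow> rat" where
  "linext G f = (\<Sum>t\<in>Poly_Mapping.keys f. Poly_Mapping.lookup f t * G t)"

lemma linext_superset:
  assumes "finite S" "Poly_Mapping.keys f \<subseteq> S"
  shows "linext G f = (\<Sum>t\<in>S. Poly_Mapping.lookup f t * G t)"
  unfolding linext_def using assms
  by (intro sum.mono_neutral_left) (auto simp: in_keys_iff)

lemma linext_zero [simp]: "linext G 0 = 0"
  by (simp add: linext_def)

lemma linext_add [simp]: "linext G (f + g) = linext G f + linext G g"
  unfolding linext_def
  by (rule setsum_keys_plus_distrib) (simp_all add: distrib_right)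

lemma linext_single [simp]: "linext G (Poly_Mapping.single t a) = a * G t"
  by (simp add: linext_superset[of "{t}"])

lemma lookup_scale [simp]:
  "Poly_Mapping.lookup (Poly_Mapping.map ((*) a) f) t = a * Poly_Mapping.lookup (f :: 'a \<Rightarrow>\<^sub>0 rat) t"
  by (simp add: Poly_Mapping.map.rep_eq when_def)

lemma keys_scale: "Poly_Mapping.keys (Poly_Mapping.map ((*) a) (f :: 'a \<Rightarrow>\<^sub>0 rat)) \<subseteq> Poly_Mapping.keys f"
  by (auto simp: in_keys_iff)

lemma linext_scale [simp]: "linext G (Poly_Mapping.map ((*) a) f) = a * linext G f"
  using linext_superset[OF _ keys_scale, of f G a]
  by (simp add: linext_def sum_distrib_left mult.assoc)

lemma scale_minus_one: "Poly_Mapping.map ((*) (- 1)) (f :: 'a \<Rightarrow>\<^sub>0 rat) = - f"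
  by (rule poly_mapping_eqI) simp

lemma linext_uminus [simp]: "linext G (- f) = - linext G f"
  using linext_scale[of G "- 1" f] by (simp add: scale_minus_one)

lemma linext_diff [simp]: "linext G (f - g) = linext G f - linext G g"
  using linext_add[of G f "- g"] by simp

lemma linext_sum [simp]: "linext G (sum f S) = (\<Sum>x\<in>S. linext G (f x))"
  by (induction S rule: infinite_finite_induct) simp_all

lemma linext_fun_add: "linext (\<lambda>t. G t + H t) f = linext G f + linext H f"
  by (simp add: linext_def distrib_left sum.distrib)

lemma linext_fun_scale: "linext (\<lambda>t. a * G t) f = a * linext G f"
  by (simp add: linext_def sum_distrib_left mult.left_commute)

lemma linext_cong:
  assumes "Poly_Mapping.keys f \<subseteq> S" "\<And>t. t \<in> S \<Longrightarrow> G t = H t"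
  shows "linext G f = linext H f"
  unfolding linext_def using assms by (intro sum.cong) auto

lemma linext_indicator: "linext (\<lambda>s. of_bool (s = t)) f = Poly_Mapping.lookup f t"
  by (subst linext_superset[of "insert t (Poly_Mapping.keys f)"])
    (auto simp: of_bool_def if_distrib cong: if_cong)

text \<open>Coefficients are themselves values of linear extensions. Most identities between formal combinations
  are proved by this rule, as \<^const>\<open>linext\<close> commutes with all operations on them.\<close>

lemma linext_eqI: "f = g" if "\<And>G. linext G f = linext G g"
  by (rule poly_mapping_eqI) (simp flip: linext_indicator add: that)

lemma free_module_simps [simp]:
  "carrier (free_module B) = {v. Poly_Mapping.keys v \<subseteq> B}"
  "\<zero>\<^bsub>free_module B\<^esub> = 0" "v \<oplus>\<^bsub>free_module B\<^esub> w = v + w"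
  "a \<odot>\<^bsub>free_module B\<^esub> v = Poly_Mapping.map ((*) a) v"
  by (simp_all add: free_module_def)

lemma module_free_module: "module rat_ring (free_module B)"
proof (rule moduleI)
  show "abelian_group (free_module B)"
  proof (rule abelian_groupI)
    show "x \<oplus>\<^bsub>free_module B\<^esub> y \<in> carrier (free_module B)"
      if "x \<in> carrier (free_module B)" "y \<in> carrier (free_module B)" for x y
      using that Poly_Mapping.keys_add[of x y] by auto
    show "\<exists>y\<in>carrier (free_module B). y \<oplus>\<^bsub>free_module B\<^esub> x = \<zero>\<^bsub>free_module B\<^esub>"
      if "x \<in> carrier (free_module B)" for x
      using that by (intro bexI[of _ "- x"]) simp_all
  qed (simp_all add: add.commute add.left_commute)
  show "a \<odot>\<^bsub>free_module B\<^esub> x \<in> carrier (free_module B)"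
    if "x \<in> carrier (free_module B)" for a x
    using that keys_scale[of a x] by auto
qed (simp_all add: cring_rat_ring poly_mapping_eq_iff fun_eq_iff lookup_add algebra_simps)

section \<open>Quotients by the annihilator of a family of functionals\<close>

definition annihilated :: "(rat, 'a, 'm) module_scheme \<Rightarrow> ('a \<Rightarrow> 'i \<Rightarrow> rat) \<Rightarrow> 'a set" where
  "annihilated V L = {x \<in> carrier V. \<forall>F. L x F = 0}"

text \<open>Meant for functions \<open>L\<close> that are constant on the coset \<open>X\<close>.\<close>

definition on_cosets :: "('a \<Rightarrow> 'b) \<Rightarrow> 'a set \<Rightarrow> 'b" where
  "on_cosets L X = L (SOME x. x \<in> X)"

text \<open>A family of linear functionals \<open>x \<mapsto> L x F\<close>, indexed by \<open>F\<close>. Dividing by the common kernel leaves a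
  space on which the family separates points, so that an element of the quotient is known once
  its values \<open>L x F\<close> are. Both Dias and Perm are quotients of this kind.\<close>

locale functional_family = module rat_ring V
  for V :: "(rat, 'a, 'm) module_scheme" (structure) +
  fixes L :: "'a \<Rightarrow> 'i \<Rightarrow> rat"
  assumes L_add: "\<lbrakk>x \<in> carrier V; y \<in> carrier V\<rbrakk> \<Longrightarrow> L (x \<oplus> y) F = L x F + L y F"
    and L_smult: "x \<in> carrier V \<Longrightarrow> L (a \<odot> x) F = a * L x F"
begin

lemma L_zero: "L \<zero> F = 0"
  using L_smult[of \<zero> 0 F] by simp

lemma L_minus: "x \<in> carrier V \<Longrightarrow> L (\<ominus> x) F = - L x F"
  using L_add[of x "\<ominus> x" F] by (simp add: L_zero M.r_neg)

lemma L_diff: "\<lbrakk>x \<in> carrier V; y \<in> carrier V\<rbrakk> \<Longrightarrow> L (x \<ominus> y) F = L x F - L y F"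
  by (simp add: a_minus_def L_add L_minus)

lemma L_finsum:
  "\<lbrakk>finite A; \<And>x. x \<in> A \<Longrightarrow> g x \<in> carrier V\<rbrakk> \<Longrightarrow> L (finsum V g A) F = (\<Sum>x\<in>A. L (g x) F)"
  by (induction A rule: finite_induct) (simp_all add: L_zero L_add Pi_def)

lemma submodule_annihilated: "submodule (annihilated V L) rat_ring V"
  by (rule submoduleI) (auto simp: annihilated_def L_zero L_minus L_add L_smult)

text \<open>Cosets are the fibres of \<open>L\<close>; all computations in the quotient rest on this description.\<close>

lemma coset_annihilated:
  assumes "x \<in> carrier V"
  shows "annihilated V L +> x = {y \<in> carrier V. L y = L x}"
proof -
  have "y \<in> annihilated V L +> x" if "y \<in> carrier V" "L y = L x" for y
  proof -
    have "y = (y \<ominus> x) \<oplus> x" 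
      using that assms by (simp add: a_minus_def M.a_assoc M.l_neg)
    moreover have "y \<ominus> x \<in> annihilated V L"
      using that assms by (simp add: annihilated_def L_diff)
    ultimately show ?thesis
      unfolding a_r_coset_def' by blast
  qed
  moreover have "y \<in> carrier V \<and> L y = L x" if "y \<in> annihilated V L +> x" for y
    using that assms by (auto simp: a_r_coset_def' annihilated_def L_add)
  ultimately show ?thesis by blast
qed

lemma on_cosets_coset:
  assumes "x \<in> carrier V"
  shows "on_cosets L (annihilated V L +> x) = L x"
proof -
  have "x \<in> annihilated V L +> x"
    using assms by (simp add: coset_annihilated)
  from someI[of "\<lambda>y. y \<in> annihilated V L +> x", OF this] show ?thesis
    unfolding on_cosets_def using assms by (simp add: coset_annihilated)
qed

abbreviation "Q \<equiv> quot_module V (annihilated V L)"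

lemma quot_carrier: "carrier Q = {annihilated V L +> x | x. x \<in> carrier V}"
  by (auto simp: quot_module_def A_RCOSETS_def')

lemma quot_eq_iff:
  assumes "X \<in> carrier Q" "Y \<in> carrier Q"
  shows "X = Y \<longleftrightarrow> on_cosets L X = on_cosets L Y"
proof -
  obtain x y where "x \<in> carrier V" "X = annihilated V L +> x" "y \<in> carrier V" "Y = annihilated V L +> y"
    using assms by (auto simp: quot_carrier)
  then show ?thesis
    by (metis on_cosets_coset coset_annihilated)
qed

lemma quot_add:
  assumes "x \<in> carrier V" "y \<in> carrier V"
  shows "(annihilated V L +> x) \<oplus>\<^bsub>Q\<^esub> (annihilated V L +> y) = annihilated V L +> (x \<oplus> y)"
proof -
  have "z \<in> set_add V (annihilated V L +> x) (annihilated V L +> y)"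
    if "z \<in> carrier V" "L z = L (x \<oplus> y)" for z
  proof -
    have "z = x \<oplus> (z \<ominus> x)"
      using that assms M.a_lcomm[of x z "\<ominus> x"] by (simp add: a_minus_def M.r_neg)
    moreover have "L (z \<ominus> x) = L y"
      using that assms by (auto simp: L_diff L_add)
    moreover have "x \<in> annihilated V L +> x" "z \<ominus> x \<in> annihilated V L +> y"
      using assms that calculation(2) by (simp_all add: coset_annihilated)
    ultimately show ?thesis
      unfolding set_add_def' by blast
  qed
  then show ?thesis
    using assms by (auto simp: quot_module_def set_add_def' coset_annihilated L_add)
qed

lemma quot_smult:
  assumes "x \<in> carrier V"
  shows "a \<odot>\<^bsub>Q\<^esub> (annihilated V L +> x) = annihilated V L +> (a \<odot> x)"
proof -
  have "annihilated V L +> (a \<odot> y) = annihilated V L +> (a \<odot> x)"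
    if "y \<in> annihilated V L +> x" for y
    using that assms by (auto simp: coset_annihilated L_smult)
  moreover have "annihilated V L +> x \<noteq> {}"
    using assms by (auto simp: coset_annihilated)
  ultimately have "(\<Union>y\<in>annihilated V L +> x. annihilated V L +> (a \<odot> y)) = annihilated V L +> (a \<odot> x)"
    by (intro SUP_eq_const)
  then show ?thesis
    by (simp add: quot_module_def)
qed

lemma quot_closed: "x \<in> carrier V \<Longrightarrow> annihilated V L +> x \<in> carrier Q"
  by (auto simp: quot_carrier)

lemma quot_cases:
  assumes "X \<in> carrier Q"
  obtains x where "x \<in> carrier V" "X = annihilated V L +> x"
  using assms by (auto simp: quot_carrier)

lemma quot_zero: "\<zero>\<^bsub>Q\<^esub> = annihilated V L +> \<zero>"
  by (subst coset_annihilated) (auto simp: quot_module_def annihilated_def fun_eq_iff L_zero)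

lemma module_quot_module: "module rat_ring Q"
proof (rule moduleI)
  have distr: "(a + b) \<odot> x = a \<odot> x \<oplus> b \<odot> x" if "x \<in> carrier V" for a b x
    using smult_l_distr[of a b x] that by simp
  show "(a \<oplus>\<^bsub>rat_ring\<^esub> b) \<odot>\<^bsub>Q\<^esub> X = a \<odot>\<^bsub>Q\<^esub> X \<oplus>\<^bsub>Q\<^esub> b \<odot>\<^bsub>Q\<^esub> X" if "X \<in> carrier Q" for a b X
    using that by (elim quot_cases) (simp add: quot_add quot_smult distr)
  show "abelian_group Q"
  proof (rule abelian_groupI)
    show "\<exists>Y\<in>carrier Q. Y \<oplus>\<^bsub>Q\<^esub> X = \<zero>\<^bsub>Q\<^esub>" if "X \<in> carrier Q" for X
    proof -
      from that obtain x where "x \<in> carrier V" "X = annihilated V L +> x" by (rule quot_cases)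
      then show ?thesis
        by (intro bexI[of _ "annihilated V L +> (\<ominus> x)"])
          (simp_all add: quot_add quot_zero quot_closed M.l_neg)
    qed
  qed (auto elim!: quot_cases simp: quot_add quot_zero quot_closed M.a_ac)
qed (auto elim!: quot_cases simp: cring_rat_ring quot_add quot_smult quot_closed
    smult_r_distr smult_assoc1[simplified] smult_one[simplified])

end

section \<open>Operads paired with functions of the head\<close>

text \<open>A monomial of arity \<open>m\<close> with distinguished input \<open>p\<close> (its head) is composed at input \<open>i\<close> with a
  monomial of arity \<open>n\<close> and head \<open>q\<close>: if \<open>i\<close> is the head, then the new head lies
  inside the inserted monomial; otherwise the old head survives, shifted when it stands to the
  right of \<open>i\<close>.\<close>

definition head_index :: "nat \<Rightarrow> nat \<Rightarrow> nat \<Rightarrow> nat \<Rightarrow> nat" where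
  "head_index n i p q = (if p < i then p else if p = i then i + q - 1 else p + n - 1)"

text \<open>The number \<open>L n f F\<close> is the value on \<open>f\<close> of the linear functional that sends a monomial with
  head \<open>p\<close> to \<open>F p\<close>. Working with test functions \<open>F\<close> instead of coordinates turns the rule for the head
  of a composition into the iterated pairing of the last assumption, with no sums to reindex.\<close>

locale head_pairing =
  fixes P :: "('a, 'k) nsoperad_scheme" and L :: "nat \<Rightarrow> 'a \<Rightarrow> (nat \<Rightarrow> rat) \<Rightarrow> rat"
  assumes comps_module: "1 \<le> n \<Longrightarrow> module rat_ring (comps P n)"
    and pcomp_closed:
      "\<lbrakk>1 \<le> i; i \<le> m; 1 \<le> n; f \<in> carrier (comps P m); g \<in> carrier (comps P n)\<rbrakk> \<Longrightarrow>
       pcomp P m n i f g \<in> carrier (comps P (m + n - 1))"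
    and L_add: "\<lbrakk>1 \<le> n; f \<in> carrier (comps P n); g \<in> carrier (comps P n)\<rbrakk> \<Longrightarrow>
       L n (f \<oplus>\<^bsub>comps P n\<^esub> g) F = L n f F + L n g F"
    and L_smult: "\<lbrakk>1 \<le> n; f \<in> carrier (comps P n)\<rbrakk> \<Longrightarrow> L n (a \<odot>\<^bsub>comps P n\<^esub> f) F = a * L n f F"
    and L_test_add: "L n f (\<lambda>p. F p + G p) = L n f F + L n f G"
    and L_test_scale: "L n f (\<lambda>p. a * F p) = a * L n f F"
    and L_cong: "\<lbrakk>1 \<le> n; f \<in> carrier (comps P n); \<And>p. p \<in> {1..n} \<Longrightarrow> F p = G p\<rbrakk> \<Longrightarrow> L n f F = L n f G"
    and L_pcomp:
      "\<lbrakk>1 \<le> i; i \<le> m; 1 \<le> n; f \<in> carrier (comps P m); g \<in> carrier (comps P n)\<rbrakk> \<Longrightarrow>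
       L (m + n - 1) (pcomp P m n i f g) F = L m f (\<lambda>p. L n g (\<lambda>q. F (head_index n i p q)))"
begin

lemma L_test_zero: "L n f (\<lambda>p. 0) = 0"
  using L_test_scale[of n f 0] by simp

lemma L_test_sum: "L n f (\<lambda>p. \<Sum>x\<in>S. G x p) = (\<Sum>x\<in>S. L n f (G x))"
  by (induction S rule: infinite_finite_induct) (simp_all add: L_test_zero L_test_add)

lemma functional_family: "1 \<le> n \<Longrightarrow> functional_family (comps P n) (L n)"
  by (intro functional_family.intro functional_family_axioms.intro comps_module L_add L_smult)

text \<open>In the iterated pairing for \<open>f \<circ>\<^sub>i g\<close> the outer pairing vanishes if \<open>f\<close> is annihilated, and the inner
  one vanishes identically if \<open>g\<close> is.\<close>

lemma ns_ideal_annihilated: "ns_ideal P (\<lambda>n. annihilated (comps P n) (L n))"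
  unfolding ns_ideal_def
proof (intro conjI allI impI ballI)
  fix n :: nat assume "1 \<le> n"
  then show "submodule (annihilated (comps P n) (L n)) rat_ring (comps P n)"
    by (intro functional_family.submodule_annihilated functional_family)
next
  fix m n i f g
  assume "1 \<le> m" "1 \<le> n" "i \<in> {1..m}"
    and fg: "f \<in> carrier (comps P m)" "g \<in> carrier (comps P n)"
      "f \<in> annihilated (comps P m) (L m) \<or> g \<in> annihilated (comps P n) (L n)"
  then have "L (m + n - 1) (pcomp P m n i f g) F = 0" for F
    by (auto simp: L_pcomp annihilated_def L_test_zero)
  then show "pcomp P m n i f g \<in> annihilated (comps P (m + n - 1)) (L (m + n - 1))"
    using \<open>i \<in> {1..m}\<close> \<open>1 \<le> n\<close> fg by (simp add: annihilated_def pcomp_closed)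
qed

lemma quot_pcomp:
  assumes I: "\<And>n. 1 \<le> n \<Longrightarrow> I n = annihilated (comps P n) (L n)"
    and "1 \<le> i" "i \<le> m" "1 \<le> n" "f \<in> carrier (comps P m)" "g \<in> carrier (comps P n)"
  shows "pcomp (quot_nsoperad P I) m n i (quot_proj P I m f) (quot_proj P I n g) =
    quot_proj P I (m + n - 1) (pcomp P m n i f g)"
proof -
  interpret m: functional_family "comps P m" "L m"
    using assms by (intro functional_family) simp
  interpret n: functional_family "comps P n" "L n"
    using assms by (intro functional_family) simp
  interpret mn: functional_family "comps P (m + n - 1)" "L (m + n - 1)"
    using assms by (intro functional_family) simp
  have X: "quot_proj P I m f = {x \<in> carrier (comps P m). L m x = L m f}"
    and Y: "quot_proj P I n g = {y \<in> carrier (comps P n). L n y = L n g}"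
    using assms by (simp_all add: quot_proj_def m.coset_annihilated n.coset_annihilated)
  have *: "quot_proj P I (m + n - 1) (pcomp P m n i x y) = quot_proj P I (m + n - 1) (pcomp P m n i f g)"
    if "x \<in> quot_proj P I m f" "y \<in> quot_proj P I n g" for x y
  proof -
    have "L (m + n - 1) (pcomp P m n i x y) = L (m + n - 1) (pcomp P m n i f g)"
      using that assms by (simp add: X Y fun_eq_iff L_pcomp)
    moreover have "pcomp P m n i x y \<in> carrier (comps P (m + n - 1))"
      using that assms by (simp add: X Y pcomp_closed)
    ultimately show ?thesis
      using assms by (simp add: quot_proj_def mn.coset_annihilated pcomp_closed)
  qed
  have "f \<in> quot_proj P I m f" "g \<in> quot_proj P I n g"
    using assms by (simp_all add: X Y)
  then have "(\<Union>x\<in>quot_proj P I m f. \<Union>y\<in>quot_proj P I n g. quot_proj P I (m + n - 1) (pcomp P m n i x y))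
     = quot_proj P I (m + n - 1) (pcomp P m n i f g)"
    by (intro SUP_eq_const *) auto
  then show ?thesis
    by (simp add: quot_nsoperad_def)
qed

text \<open>By the iterated pairing a composite of cosets does not depend on the representatives, so the whole
  structure descends to the quotient by the annihilator.\<close>

lemma quotient:
  assumes I: "\<And>n. 1 \<le> n \<Longrightarrow> I n = annihilated (comps P n) (L n)"
  shows "head_pairing (quot_nsoperad P I) (\<lambda>n. on_cosets (L n))"
proof -
  have mod: "module rat_ring (comps (quot_nsoperad P I) n)" if "1 \<le> n" for n
    using that I functional_family.module_quot_module[OF functional_family, of n]
    by (simp add: quot_nsoperad_def)
  have car: "\<exists>f\<in>carrier (comps P n). X = quot_proj P I n f"
    if "1 \<le> n" "X \<in> carrier (comps (quot_nsoperad P I) n)" for n X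
    using that functional_family.quot_carrier[OF functional_family, of n] I
    by (auto simp: quot_nsoperad_def quot_proj_def)
  have proj: "quot_proj P I n f \<in> carrier (comps (quot_nsoperad P I) n)"
    if "1 \<le> n" "f \<in> carrier (comps P n)" for n f
    using that functional_family.quot_carrier[OF functional_family, of n] I
    by (auto simp: quot_nsoperad_def quot_proj_def)
  have L: "on_cosets (L n) (quot_proj P I n f) = L n f" if "1 \<le> n" "f \<in> carrier (comps P n)" for n f
    using that I functional_family.on_cosets_coset[OF functional_family] by (simp add: quot_proj_def)
  have add: "quot_proj P I n f \<oplus>\<^bsub>comps (quot_nsoperad P I) n\<^esub> quot_proj P I n g =
      quot_proj P I n (f \<oplus>\<^bsub>comps P n\<^esub> g)"
    if "1 \<le> n" "f \<in> carrier (comps P n)" "g \<in> carrier (comps P n)" for n f g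
    using that I functional_family.quot_add[OF functional_family]
    by (simp add: quot_proj_def quot_nsoperad_def)
  have smult: "a \<odot>\<^bsub>comps (quot_nsoperad P I) n\<^esub> quot_proj P I n f =
      quot_proj P I n (a \<odot>\<^bsub>comps P n\<^esub> f)"
    if "1 \<le> n" "f \<in> carrier (comps P n)" for n f a
    using that I functional_family.quot_smult[OF functional_family]
    by (simp add: quot_proj_def quot_nsoperad_def)
  have cl: "f \<oplus>\<^bsub>comps P n\<^esub> g \<in> carrier (comps P n)" "a \<odot>\<^bsub>comps P n\<^esub> f \<in> carrier (comps P n)"
    if "1 \<le> n" "f \<in> carrier (comps P n)" "g \<in> carrier (comps P n)" for n f g a
    using that module.smult_closed[OF comps_module, of n a f]
      abelian_monoid.a_closed[OF abelian_group.axioms(1)[OF module.axioms(2)[OF comps_module]], of n f g]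
    by simp_all
  show ?thesis
  proof (rule head_pairing.intro)
    fix m n i X Y
    assume mni: "1 \<le> i" "i \<le> m" "1 \<le> n" "X \<in> carrier (comps (quot_nsoperad P I) m)"
      "Y \<in> carrier (comps (quot_nsoperad P I) n)"
    then obtain f g where fg: "f \<in> carrier (comps P m)" "g \<in> carrier (comps P n)"
      "X = quot_proj P I m f" "Y = quot_proj P I n g"
      using car[of m X] car[of n Y] by auto
    show "pcomp (quot_nsoperad P I) m n i X Y \<in> carrier (comps (quot_nsoperad P I) (m + n - 1))"
      using mni(1-3) fg by (simp add: quot_pcomp[OF I] proj pcomp_closed)
    show "on_cosets (L (m + n - 1)) (pcomp (quot_nsoperad P I) m n i X Y) F =
       on_cosets (L m) X (\<lambda>p. on_cosets (L n) Y (\<lambda>q. F (head_index n i p q)))" for F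
      using mni(1-3) fg by (simp add: quot_pcomp[OF I] L pcomp_closed L_pcomp)
  next
    fix n :: nat and X Y F
    assume n: "1 \<le> n" "X \<in> carrier (comps (quot_nsoperad P I) n)" "Y \<in> carrier (comps (quot_nsoperad P I) n)"
    then obtain f g where fg: "f \<in> carrier (comps P n)" "g \<in> carrier (comps P n)"
      "X = quot_proj P I n f" "Y = quot_proj P I n g"
      using car by metis
    with n show "on_cosets (L n) (X \<oplus>\<^bsub>comps (quot_nsoperad P I) n\<^esub> Y) F = on_cosets (L n) X F + on_cosets (L n) Y F"
      by (simp add: add L L_add cl)
  next
    fix n :: nat and X F a
    assume n: "1 \<le> n" "X \<in> carrier (comps (quot_nsoperad P I) n)"
    then obtain f where fg: "f \<in> carrier (comps P n)" "X = quot_proj P I n f"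
      using car by metis
    with n show "on_cosets (L n) (a \<odot>\<^bsub>comps (quot_nsoperad P I) n\<^esub> X) F = a * on_cosets (L n) X F"
      by (simp add: smult L L_smult cl)
  next
    fix n :: nat and X and F G :: "nat \<Rightarrow> rat"
    assume n: "1 \<le> n" "X \<in> carrier (comps (quot_nsoperad P I) n)" "\<And>p. p \<in> {1..n} \<Longrightarrow> F p = G p"
    then obtain f where fg: "f \<in> carrier (comps P n)" "X = quot_proj P I n f"
      using car by metis
    with n show "on_cosets (L n) X F = on_cosets (L n) X G"
      using L_cong[OF n(1) fg(1) n(3)] by (simp add: L)
  qed (simp_all add: mod, simp_all add: on_cosets_def L_test_add L_test_scale)
qed

end

section \<open>The head of a monomial in the free operad\<close>

text \<open>The head of \<open>x \<stileturn> y\<close> is that of \<open>x\<close>, the head of \<open>x \<turnstile> y\<close> that of \<open>y\<close>: the horizontal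
  stroke points to the head.\<close>

fun head :: "dias_op tree \<Rightarrow> nat" where
  "head Leaf = 1"
| "head (Node l a r) = (case a of LeftProd \<Rightarrow> head l | RightProd \<Rightarrow> size1 l + head r)"

lemma head_bounds: "1 \<le> head t" "head t \<le> size1 t"
  by (induction t) (auto split: dias_op.splits)

lemma size1_graft: "i \<le> size1 t \<Longrightarrow> size1 (graft i t s) = size1 t + size1 s - 1"
proof (induction t arbitrary: i)
  case (Node l a r)
  with size1_ge0[of l] size1_ge0[of r] size1_ge0[of s] show ?case
    by (auto simp del: size1_ge0)
qed simp

lemma head_graft:
  "\<lbrakk>1 \<le> i; i \<le> size1 t\<rbrakk> \<Longrightarrow> head (graft i t s) = head_index (size1 s) i (head t) (head s)"
proof (induction t arbitrary: i)
  case Leaf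
  then show ?case using head_bounds[of s] by (simp add: head_index_def)
next
  case (Node l a r)
  have "0 < size1 s" by simp
  with Node head_bounds[of l] head_bounds[of r] head_bounds[of s] show ?case
    by (auto simp: head_index_def size1_graft split: dias_op.splits)
qed

lemma one_le_size1: "1 \<le> size1 t"
  by (simp add: size1_size)

lemma free_nsoperad_simps [simp]:
  "comps free_nsoperad n = free_module {t. size1 t = n}"
  by (simp add: free_nsoperad_def)

lemma linext_free_pcomp:
  "linext G (pcomp free_nsoperad m n i f g) = linext (\<lambda>t. linext (\<lambda>s. G (graft i t s)) g) f"
  by (simp add: free_nsoperad_def linext_def[of _ f] linext_def[of _ g] sum_distrib_left mult.assoc)

lemma keys_linext: "Poly_Mapping.keys f \<subseteq> S" if "\<And>t. t \<notin> S \<Longrightarrow> linext (\<lambda>s. of_bool (s = t)) f = 0"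
  using that by (auto simp: linext_indicator in_keys_iff)

definition free_pairing :: "(dias_op tree \<Rightarrow>\<^sub>0 rat) \<Rightarrow> (nat \<Rightarrow> rat) \<Rightarrow> rat" where
  "free_pairing f F = linext (\<lambda>t. F (head t)) f"

lemma head_pairing_free: "head_pairing free_nsoperad (\<lambda>n. free_pairing)"
proof (rule head_pairing.intro)
  fix m n i :: nat and f g :: "dias_op tree \<Rightarrow>\<^sub>0 rat"
  assume a: "1 \<le> i" "i \<le> m" "1 \<le> n" "f \<in> carrier (comps free_nsoperad m)"
    "g \<in> carrier (comps free_nsoperad n)"
  have "linext (\<lambda>s. of_bool (s = t)) (pcomp free_nsoperad m n i f g) = 0" if "size1 t \<noteq> m + n - 1" for t
  proof -
    have "linext (\<lambda>t'. linext (\<lambda>s. of_bool (graft i t' s = t)) g) f = linext (\<lambda>_. 0) f"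
    proof (rule linext_cong)
      show "Poly_Mapping.keys f \<subseteq> {t. size1 t = m}" using a by simp
      fix t' :: "dias_op tree" assume t': "t' \<in> {t. size1 t = m}"
      have "linext (\<lambda>s. of_bool (graft i t' s = t)) g = linext (\<lambda>_. 0) g"
        by (rule linext_cong[of _ "{t. size1 t = n}"]) (use a t' that size1_graft[of i t'] in auto)
      then show "linext (\<lambda>s. of_bool (graft i t' s = t)) g = 0"
        by (simp add: linext_def)
    qed
    then show ?thesis by (simp add: linext_free_pcomp) (simp add: linext_def)
  qed
  then show "pcomp free_nsoperad m n i f g \<in> carrier (comps free_nsoperad (m + n - 1))"
    using keys_linext[of "{t. size1 t = m + n - 1}" "pcomp free_nsoperad m n i f g"] by simp
  show "free_pairing (pcomp free_nsoperad m n i f g) F =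
      free_pairing f (\<lambda>p. free_pairing g (\<lambda>q. F (head_index n i p q)))" for F
    unfolding free_pairing_def linext_free_pcomp
    by (rule linext_cong[of _ "{t. size1 t = m}"], use a in simp)
      (rule linext_cong[of _ "{t. size1 t = n}"], use a head_graft in auto)
next
  show "free_pairing f F = free_pairing f G"
    if "f \<in> carrier (comps free_nsoperad n)" "\<And>p. p \<in> {1..n} \<Longrightarrow> F p = G p" for f n F G
    unfolding free_pairing_def
    by (rule linext_cong[of _ "{t. size1 t = n}"]) (use that head_bounds in auto)
qed (simp_all add: module_free_module free_pairing_def linext_fun_add linext_fun_scale)

section \<open>The ideal defining Dias\<close>

fun append_leaves :: "dias_op tree \<Rightarrow> nat \<Rightarrow> dias_op tree" where
  "append_leaves x 0 = x"
| "append_leaves x (Suc j) = \<langle>append_leaves x j, \<stileturn>, \<langle>\<rangle>\<rangle>"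

fun prepend_leaves :: "nat \<Rightarrow> dias_op tree \<Rightarrow> dias_op tree" where
  "prepend_leaves 0 x = x"
| "prepend_leaves (Suc j) x = \<langle>\<langle>\<rangle>, \<turnstile>, prepend_leaves j x\<rangle>"

lemma append_leaves_add: "append_leaves (append_leaves x a) b = append_leaves x (a + b)"
  by (induction b) simp_all

lemma prepend_leaves_add: "prepend_leaves a (prepend_leaves b x) = prepend_leaves (a + b) x"
  by (induction a) simp_all

text \<open>The monomial \<open>x\<^sub>1 \<turnstile> (\<dots> \<turnstile> ((x\<^sub>p \<stileturn> x\<^bsub>p+1\<^esub>) \<dots> \<stileturn> x\<^sub>n))\<close>, whose head is \<open>p\<close>.\<close>

definition normal_tree :: "nat \<Rightarrow> nat \<Rightarrow> dias_op tree" where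
  "normal_tree n p = prepend_leaves (p - 1) (append_leaves \<langle>\<rangle> (n - p))"

lemma size1_append: "size1 (append_leaves x j) = size1 x + j"
  and size1_prepend: "size1 (prepend_leaves j x) = j + size1 x"
  by (induction j) simp_all

lemma head_append: "head (append_leaves x j) = head x"
  and head_prepend: "head (prepend_leaves j x) = j + head x"
  by (induction j) simp_all

lemma size1_normal_tree: "p \<in> {1..n} \<Longrightarrow> size1 (normal_tree n p) = n"
  and head_normal_tree: "p \<in> {1..n} \<Longrightarrow> head (normal_tree n p) = p"
  by (auto simp: normal_tree_def size1_append size1_prepend head_append head_prepend)

text \<open>An arbitrary ideal containing the relations of Dias. The aim is to show that it contains every
  combination of monomials on which all functionals of the head vanish.\<close>

locale dias_ideal_above =
  fixes I :: "nat \<Rightarrow> (dias_op tree \<Rightarrow>\<^sub>0 rat) set"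
  assumes ideal: "ns_ideal free_nsoperad I"
    and relations: "\<And>k. 1 \<le> k \<Longrightarrow> dias_relations k \<subseteq> I k"
begin

lemma
  assumes "1 \<le> n"
  shows I_zero: "0 \<in> I n"
    and I_add: "\<lbrakk>f \<in> I n; g \<in> I n\<rbrakk> \<Longrightarrow> f + g \<in> I n"
    and I_scale: "f \<in> I n \<Longrightarrow> Poly_Mapping.map ((*) a) f \<in> I n"
    and I_uminus: "f \<in> I n \<Longrightarrow> - f \<in> I n"
proof -
  have sub: "submodule (I n) rat_ring (free_module {t. size1 t = n})"
    using ideal assms by (simp add: ns_ideal_def)
  note E = module.submoduleE[OF module_free_module sub]
  show add: "f + g \<in> I n" if "f \<in> I n" "g \<in> I n" for f g
    using E(5) that by simp
  show scale: "Poly_Mapping.map ((*) a) f \<in> I n" if "f \<in> I n" for a f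
    using E(4) that by simp
  show uminus: "- f \<in> I n" if "f \<in> I n" for f
    using scale[OF that, of "- 1"] by (simp only: scale_minus_one)
  obtain f where "f \<in> I n" using E(2) by auto
  from add[OF this uminus[OF this]] show "0 \<in> I n" by simp
qed

lemma I_sum: "\<lbrakk>1 \<le> n; \<And>x. x \<in> S \<Longrightarrow> f x \<in> I n\<rbrakk> \<Longrightarrow> sum f S \<in> I n"
  by (induction S rule: infinite_finite_induct) (simp_all add: I_zero I_add)

definition tree_cong :: "dias_op tree \<Rightarrow> dias_op tree \<Rightarrow> bool" (infix \<open>\<approx>\<close> 50) where
  "t \<approx> t' \<longleftrightarrow> size1 t = size1 t' \<and> basis_vec t - basis_vec t' \<in> I (size1 t)"

lemma cong_refl [simp]: "t \<approx> t"
  by (simp add: tree_cong_def I_zero one_le_size1)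

lemma cong_sym: "t \<approx> t' \<Longrightarrow> t' \<approx> t"
  using I_uminus[OF one_le_size1, of "basis_vec t - basis_vec t'" t] by (auto simp: tree_cong_def)

lemma cong_trans [trans]: "\<lbrakk>t \<approx> u; u \<approx> v\<rbrakk> \<Longrightarrow> t \<approx> v"
  using I_add[OF one_le_size1, of "basis_vec t - basis_vec u" t "basis_vec u - basis_vec v"]
  by (auto simp: tree_cong_def)

lemma cong_graft:
  assumes "1 \<le> i" "i \<le> size1 t" "t \<approx> t'" "s \<approx> s'"
  shows "graft i t s \<approx> graft i t' s'"
proof -
  have *: "pcomp free_nsoperad (size1 t) (size1 s) i f g \<in> I (size1 t + size1 s - 1)"
    if "f \<in> carrier (comps free_nsoperad (size1 t))" "g \<in> carrier (comps free_nsoperad (size1 s))"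
      "f \<in> I (size1 t) \<or> g \<in> I (size1 s)" for f g
    using ideal that assms(1,2) one_le_size1[of t] one_le_size1[of s] unfolding ns_ideal_def
    by (meson atLeastAtMost_iff)
  have t': "size1 t' = size1 t" and s': "size1 s' = size1 s"
    using assms by (simp_all add: tree_cong_def)
  have keys: "Poly_Mapping.keys (basis_vec u - basis_vec u') \<subseteq> {v. size1 v = size1 u}"
    if "size1 u = size1 u'" for u u' :: "dias_op tree"
    using that by (auto simp: in_keys_iff lookup_minus lookup_single when_def split: if_splits)
  have "pcomp free_nsoperad (size1 t) (size1 s) i (basis_vec t - basis_vec t') (basis_vec s) =
      basis_vec (graft i t s) - basis_vec (graft i t' s)"
    by (rule linext_eqI) (simp add: linext_free_pcomp)
  moreover have "pcomp free_nsoperad (size1 t) (size1 s) i (basis_vec t') (basis_vec s - basis_vec s') =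
      basis_vec (graft i t' s) - basis_vec (graft i t' s')"
    by (rule linext_eqI) (simp add: linext_free_pcomp)
  ultimately have "graft i t s \<approx> graft i t' s" "graft i t' s \<approx> graft i t' s'"
    using *[of "basis_vec t - basis_vec t'" "basis_vec s"] *[of "basis_vec t'" "basis_vec s - basis_vec s'"]
      assms keys t' s' by (simp_all add: tree_cong_def size1_graft)
  then show ?thesis by (rule cong_trans)
qed

text \<open>Both subtrees of a node are grafted onto the tree with a single node.\<close>

lemma cong_Node: "\<lbrakk>l \<approx> l'; r \<approx> r'\<rbrakk> \<Longrightarrow> \<langle>l, a, r\<rangle> \<approx> \<langle>l', a, r'\<rangle>"
  using cong_graft[of 1 "\<langle>\<langle>\<rangle>, a, r\<rangle>" "\<langle>\<langle>\<rangle>, a, r'\<rangle>" l l']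
    cong_graft[of 2 "\<langle>\<langle>\<rangle>, a, \<langle>\<rangle>\<rangle>" "\<langle>\<langle>\<rangle>, a, \<langle>\<rangle>\<rangle>" r r'] by simp

lemma cong_instance:
  assumes "t \<approx> t'" "size1 t = 3"
  shows "graft 1 (graft 2 (graft 3 t z) y) x \<approx> graft 1 (graft 2 (graft 3 t' z) y) x"
  by (intro cong_graft assms cong_refl) (use assms in \<open>simp_all add: size1_graft\<close>)

text \<open>The relations for arbitrary subtrees: substitute into the three inputs, from right to left so that
  the numbers of the inputs still to be filled do not change.\<close>

lemma dias_cong:
  shows "\<langle>x, \<stileturn>, \<langle>y, \<turnstile>, z\<rangle>\<rangle> \<approx> \<langle>x, \<stileturn>, \<langle>y, \<stileturn>, z\<rangle>\<rangle>"
    and "\<langle>x, \<stileturn>, \<langle>y, \<stileturn>, z\<rangle>\<rangle> \<approx> \<langle>\<langle>x, \<stileturn>, y\<rangle>, \<stileturn>, z\<rangle>"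
    and "\<langle>x, \<turnstile>, \<langle>y, \<stileturn>, z\<rangle>\<rangle> \<approx> \<langle>\<langle>x, \<turnstile>, y\<rangle>, \<stileturn>, z\<rangle>"
    and "\<langle>x, \<turnstile>, \<langle>y, \<turnstile>, z\<rangle>\<rangle> \<approx> \<langle>\<langle>x, \<turnstile>, y\<rangle>, \<turnstile>, z\<rangle>"
    and "\<langle>\<langle>x, \<turnstile>, y\<rangle>, \<turnstile>, z\<rangle> \<approx> \<langle>\<langle>x, \<stileturn>, y\<rangle>, \<turnstile>, z\<rangle>"
proof -
  let ?r = "\<lambda>a b. \<langle>\<langle>\<rangle>, a, \<langle>\<langle>\<rangle>, b, \<langle>\<rangle>\<rangle>\<rangle>" and ?l = "\<lambda>a b. \<langle>\<langle>\<langle>\<rangle>, a, \<langle>\<rangle>\<rangle>, b, \<langle>\<rangle>\<rangle>"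
  have "?r \<stileturn> \<turnstile> \<approx> ?r \<stileturn> \<stileturn>" "?r \<stileturn> \<stileturn> \<approx> ?l \<stileturn> \<stileturn>" "?r \<turnstile> \<stileturn> \<approx> ?l \<turnstile> \<stileturn>"
    "?r \<turnstile> \<turnstile> \<approx> ?l \<turnstile> \<turnstile>" "?l \<turnstile> \<turnstile> \<approx> ?l \<stileturn> \<turnstile>"
    using relations[of 3] by (simp_all add: dias_relations_def tree_cong_def)
  from this[THEN cong_instance, of z y x]
  show "\<langle>x, \<stileturn>, \<langle>y, \<turnstile>, z\<rangle>\<rangle> \<approx> \<langle>x, \<stileturn>, \<langle>y, \<stileturn>, z\<rangle>\<rangle>"
    "\<langle>x, \<stileturn>, \<langle>y, \<stileturn>, z\<rangle>\<rangle> \<approx> \<langle>\<langle>x, \<stileturn>, y\<rangle>, \<stileturn>, z\<rangle>"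
    "\<langle>x, \<turnstile>, \<langle>y, \<stileturn>, z\<rangle>\<rangle> \<approx> \<langle>\<langle>x, \<turnstile>, y\<rangle>, \<stileturn>, z\<rangle>"
    "\<langle>x, \<turnstile>, \<langle>y, \<turnstile>, z\<rangle>\<rangle> \<approx> \<langle>\<langle>x, \<turnstile>, y\<rangle>, \<turnstile>, z\<rangle>"
    "\<langle>\<langle>x, \<turnstile>, y\<rangle>, \<turnstile>, z\<rangle> \<approx> \<langle>\<langle>x, \<stileturn>, y\<rangle>, \<turnstile>, z\<rangle>"
    by simp_all
qed

lemma cong_append: "x \<approx> y \<Longrightarrow> append_leaves x j \<approx> append_leaves y j"
  by (induction j) (simp_all add: cong_Node)

lemma cong_prepend: "x \<approx> y \<Longrightarrow> prepend_leaves j x \<approx> prepend_leaves j y"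
  by (induction j) (simp_all add: cong_Node)

text \<open>In \<open>x \<stileturn> r\<close> only the number of inputs of \<open>r\<close> matters, since the relations allow \<open>r\<close> to be split off
  leaf by leaf with all its operations turned into \<open>\<stileturn>\<close>. The next lemma is
  the mirror image.\<close>

lemma left_product_cong: "\<langle>x, \<stileturn>, r\<rangle> \<approx> append_leaves x (size1 r)"
proof (induction r arbitrary: x)
  case (Node l a r)
  have "\<langle>x, \<stileturn>, \<langle>l, a, r\<rangle>\<rangle> \<approx> \<langle>\<langle>x, \<stileturn>, l\<rangle>, \<stileturn>, r\<rangle>"
    by (cases a) (auto intro: dias_cong cong_trans)
  also have "\<dots> \<approx> append_leaves \<langle>x, \<stileturn>, l\<rangle> (size1 r)"
    by (rule Node)
  also have "\<dots> \<approx> append_leaves (append_leaves x (size1 l)) (size1 r)"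
    by (intro cong_append Node)
  finally show ?case by (simp add: append_leaves_add)
qed (simp add: One_nat_def)

lemma right_product_cong: "\<langle>l, \<turnstile>, x\<rangle> \<approx> prepend_leaves (size1 l) x"
proof (induction l arbitrary: x)
  case (Node l a r)
  have "\<langle>\<langle>l, a, r\<rangle>, \<turnstile>, x\<rangle> \<approx> \<langle>l, \<turnstile>, \<langle>r, \<turnstile>, x\<rangle>\<rangle>"
    by (cases a) (blast intro: dias_cong(4,5) cong_trans cong_sym)+
  also have "\<dots> \<approx> prepend_leaves (size1 l) \<langle>r, \<turnstile>, x\<rangle>"
    by (rule Node)
  also have "\<dots> \<approx> prepend_leaves (size1 l) (prepend_leaves (size1 r) x)"
    by (intro cong_prepend Node)
  finally show ?case by (simp add: prepend_leaves_add)
qed (simp add: One_nat_def)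

text \<open>The relation \<open>x \<turnstile> (y \<stileturn> z) = (x \<turnstile> y) \<stileturn> z\<close> lets leaves on either side of \<open>x\<close> be
  attached in any order.\<close>

lemma append_prepend_cong:
  "append_leaves (prepend_leaves a x) b \<approx> prepend_leaves a (append_leaves x b)"
proof (induction b)
  case (Suc b)
  have step: "\<langle>prepend_leaves a y, \<stileturn>, \<langle>\<rangle>\<rangle> \<approx> prepend_leaves a \<langle>y, \<stileturn>, \<langle>\<rangle>\<rangle>" for y
  proof (induction a)
    case (Suc a)
    have "\<langle>\<langle>\<langle>\<rangle>, \<turnstile>, prepend_leaves a y\<rangle>, \<stileturn>, \<langle>\<rangle>\<rangle> \<approx> \<langle>\<langle>\<rangle>, \<turnstile>, \<langle>prepend_leaves a y, \<stileturn>, \<langle>\<rangle>\<rangle>\<rangle>"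
      by (rule cong_sym[OF dias_cong(3)])
    also have "\<dots> \<approx> \<langle>\<langle>\<rangle>, \<turnstile>, prepend_leaves a \<langle>y, \<stileturn>, \<langle>\<rangle>\<rangle>\<rangle>"
      by (intro cong_Node Suc cong_refl)
    finally show ?case by simp
  qed simp
  have "append_leaves (prepend_leaves a x) (Suc b) \<approx> \<langle>prepend_leaves a (append_leaves x b), \<stileturn>, \<langle>\<rangle>\<rangle>"
    using Suc by (simp add: cong_Node)
  also have "\<dots> \<approx> prepend_leaves a (append_leaves x (Suc b))"
    using step by simp
  finally show ?case .
qed simp

lemma cong_normal_tree: "t \<approx> normal_tree (size1 t) (head t)"
proof (induction t)
  case (Node l a r)
  note bounds = head_bounds[of l] head_bounds[of r]
  show ?case
  proof (cases a)
    case LeftProd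
    have "\<langle>l, \<stileturn>, r\<rangle> \<approx> append_leaves l (size1 r)"
      by (rule left_product_cong)
    also have "\<dots> \<approx> append_leaves (normal_tree (size1 l) (head l)) (size1 r)"
      by (intro cong_append Node)
    also have "\<dots> \<approx> prepend_leaves (head l - 1) (append_leaves (append_leaves \<langle>\<rangle> (size1 l - head l)) (size1 r))"
      unfolding normal_tree_def by (rule append_prepend_cong)
    finally show ?thesis
      using LeftProd bounds by (simp add: append_leaves_add normal_tree_def)
  next
    case RightProd
    have "\<langle>l, \<turnstile>, r\<rangle> \<approx> prepend_leaves (size1 l) r"
      by (rule right_product_cong)
    also have "\<dots> \<approx> prepend_leaves (size1 l) (normal_tree (size1 r) (head r))"
      by (intro cong_prepend Node)
    finally show ?thesis
      using RightProd bounds by (simp add: prepend_leaves_add normal_tree_def)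
  qed
qed (simp add: normal_tree_def)

text \<open>Replacing each monomial by its normal form changes \<open>f\<close> by an element of the ideal and produces
  a combination of the normal monomials whose coefficients are functionals of the
  head applied to \<open>f\<close>, thus zero.\<close>

lemma annihilated_subset:
  assumes n: "1 \<le> n"
  shows "annihilated (comps free_nsoperad n) free_pairing \<subseteq> I n"
proof
  fix f assume "f \<in> annihilated (comps free_nsoperad n) free_pairing"
  then have f: "Poly_Mapping.keys f \<subseteq> {t. size1 t = n}" and zero: "free_pairing f F = 0" for F
    by (simp_all add: annihilated_def)
  let ?d = "\<lambda>t. basis_vec t - basis_vec (normal_tree n (head t))"
  have "f = (\<Sum>t\<in>Poly_Mapping.keys f. Poly_Mapping.map ((*) (Poly_Mapping.lookup f t)) (?d t))"
  proof (rule linext_eqI)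
    fix G
    have "linext G f = linext G f - free_pairing f (\<lambda>p. G (normal_tree n p))"
      by (simp add: zero)
    then show "linext G f =
        linext G (\<Sum>t\<in>Poly_Mapping.keys f. Poly_Mapping.map ((*) (Poly_Mapping.lookup f t)) (?d t))"
      by (simp add: free_pairing_def linext_def[of _ f] right_diff_distrib sum_subtractf)
  qed
  also have "\<dots> \<in> I n"
    by (intro I_sum I_scale n) (use f cong_normal_tree in \<open>auto simp: tree_cong_def\<close>)
  finally show "f \<in> I n" .
qed

end

text \<open>The annihilator is an ideal containing the relations and is contained in every other one. So Dias has in arity \<open>n\<close> one basis element for each possible head.\<close>

lemma dias_ideal_eq:
  assumes "1 \<le> n"
  shows "dias_ideal n = annihilated (comps free_nsoperad n) free_pairing"
proof
  let ?I = "\<lambda>n. annihilated (comps free_nsoperad n) free_pairing"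
  have "dias_relations k \<subseteq> ?I k" for k
    by (auto simp: dias_relations_def annihilated_def free_pairing_def in_keys_iff lookup_minus
        lookup_single when_def split: if_splits)
  then show "dias_ideal n \<subseteq> ?I n"
    using head_pairing.ns_ideal_annihilated[OF head_pairing_free]
    unfolding dias_ideal_def ns_ideal_gen_def by blast
  show "?I n \<subseteq> dias_ideal n"
    unfolding dias_ideal_def ns_ideal_gen_def
    using dias_ideal_above.annihilated_subset[OF dias_ideal_above.intro assms] by blast
qed

section \<open>Composition of permutations and heads\<close>

lemma head_index_range:
  "\<lbrakk>i \<in> {1..m}; p \<in> {1..m}; q \<in> {1..n}\<rbrakk> \<Longrightarrow> head_index n i p q \<in> {1..m + n - 1}"
  by (auto simp: head_index_def)

lemma head_index_surj:
  assumes "i \<in> {1..m}" "1 \<le> n" "k \<in> {1..m + n - 1}"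
  obtains p q where "p \<in> {1..m}" "q \<in> {1..n}" "k = head_index n i p q"
proof -
  consider "k < i" | "i + n \<le> k" | "i \<le> k" "k < i + n" by linarith
  then show ?thesis
  proof cases
    case 1
    with that[of k 1] assms show ?thesis by (simp add: head_index_def)
  next
    case 2
    with assms have "i < k + 1 - n" "k + 1 - n \<le> m" by auto
    with that[of "k + 1 - n" 1] 2 assms show ?thesis by (simp add: head_index_def)
  next
    case 3
    then have "k + 1 - i \<in> {1..n}" by auto
    with that[of i "k + 1 - i"] 3 assms show ?thesis by (simp add: head_index_def)
  qed
qed

text \<open>A monomial with head \<open>p\<close> and variables in the order \<open>s\<close> has the variable \<open>x\<^bsub>s p\<^esub>\<close> in its head. Substituting
  for the variable \<open>x\<^sub>i\<close>, which stands in position \<open>inv s i\<close>, acts on these head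
  variables by the same rule as on head positions. This is where the order of the
  variables disappears from the composition.\<close>

lemma perm_pcomp_head_index:
  assumes s: "s permutes {1..m}" and t: "t permutes {1..n}" and "i \<in> {1..m}"
    and "p \<in> {1..m}" "q \<in> {1..n}"
  shows "perm_pcomp m n i s t (head_index n (inv' s i) p q) = head_index n i (s p) (t q)"
proof -
  define P where "P = inv' s i"
  have P: "P \<in> {1..m}"
    unfolding P_def using assms(3) permutes_in_image[OF permutes_inv[OF s]] by blast
  have range: "head_index n P p q \<in> {1..m + n - 1}"
    using P assms(4,5) by (rule head_index_range)
  have sP: "s p = i" if "p = P"
    using that permutes_inverses(1)[OF s] by (simp add: P_def)
  have s_neq: "s p \<noteq> i" if "p \<noteq> P"
    using that permutes_inverses(2)[OF s] by (auto simp: P_def)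
  have unfolded: "perm_pcomp m n i s t k =
      (if k < P then let a = s k in if a < i then a else a + n - 1
       else if k < P + n then t (k + 1 - P) + i - 1
       else let a = s (k + 1 - n) in if a < i then a else a + n - 1)" if "k \<in> {1..m + n - 1}" for k
    using that unfolding perm_pcomp_def P_def Let_def by (simp only: simp_thms if_False)
  consider "p < P" | "p = P" | "P < p" by linarith
  then have "perm_pcomp m n i s t (head_index n P p q) = head_index n i (s p) (t q)"
  proof cases
    case 1
    then have "head_index n P p q = p" by (simp add: head_index_def)
    then show ?thesis
      using 1 s_neq unfolded[OF range] by (simp add: head_index_def Let_def)
  next
    case 2
    then have "head_index n P p q = P + q - 1" by (simp add: head_index_def)
    moreover have "P \<le> P + q - 1" "P + q - 1 < P + n" "P + q - 1 + 1 - P = q"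
      using assms(5) P by auto
    ultimately show ?thesis
      using sP[OF 2] unfolded[OF range] by (simp add: head_index_def add.commute)
  next
    case 3
    then have "head_index n P p q = p + n - 1" by (simp add: head_index_def)
    moreover have "P + n \<le> p + n - 1" "p + n - 1 + 1 - n = p"
      using assms(4,5) 3 P by auto
    ultimately show ?thesis
      using s_neq 3 unfolded[OF range] by (simp add: head_index_def Let_def)
  qed
  then show ?thesis by (simp add: P_def)
qed

text \<open>Surjectivity comes from the previous formula, as every index has the form
  \<^const>\<open>head_index\<close> \<open>n i p q\<close>.\<close>

lemma permutes_perm_pcomp:
  assumes s: "s permutes {1..m}" and t: "t permutes {1..n}" and i: "i \<in> {1..m}" and n: "1 \<le> n"
  shows "perm_pcomp m n i s t permutes {1..m + n - 1}"
proof (rule bij_imp_permutes)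
  have i': "inv' s i \<in> {1..m}"
    using i permutes_in_image[OF permutes_inv[OF s]] by blast
  have "perm_pcomp m n i s t ` {1..m + n - 1} = {1..m + n - 1}"
  proof (intro equalityI subsetI)
    fix k assume "k \<in> perm_pcomp m n i s t ` {1..m + n - 1}"
    then obtain j where j: "j \<in> {1..m + n - 1}" "k = perm_pcomp m n i s t j" by blast
    then obtain p q where pq: "p \<in> {1..m}" "q \<in> {1..n}" "j = head_index n (inv' s i) p q"
      using head_index_surj[OF i' n] by metis
    then show "k \<in> {1..m + n - 1}"
      using j head_index_range[of i m "s p" "t q" n] permutes_in_image[OF s] permutes_in_image[OF t]
      by (simp add: perm_pcomp_head_index[OF s t i] i del: atLeastAtMost_iff)
  next
    fix k assume "k \<in> {1..m + n - 1}"
    then obtain p q where pq: "p \<in> {1..m}" "q \<in> {1..n}" "k = head_index n i p q"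
      using head_index_surj[OF i n] by metis
    then have pq': "inv' s p \<in> {1..m}" "inv' t q \<in> {1..n}"
      using permutes_in_image[OF permutes_inv[OF s]] permutes_in_image[OF permutes_inv[OF t]] by blast+
    have "perm_pcomp m n i s t (head_index n (inv' s i) (inv' s p) (inv' t q)) = k"
      using pq by (simp add: perm_pcomp_head_index[OF s t i pq'] permutes_inverses[OF s] permutes_inverses[OF t])
    then show "k \<in> perm_pcomp m n i s t ` {1..m + n - 1}"
      using head_index_range[OF i' pq'] by blast
  qed
  then show "bij_betw (perm_pcomp m n i s t) {1..m + n - 1} {1..m + n - 1}"
    by (simp add: bij_betw_def finite_surj_inj)
  show "perm_pcomp m n i s t k = k" if "k \<notin> {1..m + n - 1}" for k
    using that by (simp only: perm_pcomp_def Let_def simp_thms if_True)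
qed

section \<open>Symmetrization of a head pairing\<close>

lemma symmetrization_simps [simp]:
  "carrier (comps (symmetrization P) n) = perms n \<rightarrow>\<^sub>E carrier (comps P n)"
  "\<zero>\<^bsub>comps (symmetrization P) n\<^esub> = (\<lambda>s\<in>perms n. \<zero>\<^bsub>comps P n\<^esub>)"
  "u \<oplus>\<^bsub>comps (symmetrization P) n\<^esub> v = (\<lambda>s\<in>perms n. u s \<oplus>\<^bsub>comps P n\<^esub> v s)"
  "a \<odot>\<^bsub>comps (symmetrization P) n\<^esub> u = (\<lambda>s\<in>perms n. a \<odot>\<^bsub>comps P n\<^esub> u s)"
  "sact (symmetrization P) n \<sigma> u = (\<lambda>s\<in>perms n. u (inv' \<sigma> \<circ> s))"
  by (simp_all add: symmetrization_def)

lemma component_closed: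
  "\<lbrakk>u \<in> perms n \<rightarrow>\<^sub>E carrier (comps P n); s permutes {1..n}\<rbrakk> \<Longrightarrow> u s \<in> carrier (comps P n)"
  by auto

lemma module_symmetrization:
  assumes "module rat_ring (comps P n)"
  shows "module rat_ring (comps (symmetrization P) n)"
proof -
  interpret P: module rat_ring "comps P n" by (rule assms)
  let ?S = "comps (symmetrization P) n"
  note ext = PiE_ext[where k = "perms n" and s = "\<lambda>_. carrier (comps P n)"]
  show ?thesis
  proof (rule moduleI)
    show "abelian_group ?S"
    proof (rule abelian_groupI)
      show "\<exists>y\<in>carrier ?S. y \<oplus>\<^bsub>?S\<^esub> x = \<zero>\<^bsub>?S\<^esub>" if "x \<in> carrier ?S" for x
        using that by (intro bexI[of _ "\<lambda>s\<in>perms n. \<ominus>\<^bsub>comps P n\<^esub> x s"])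
          (auto intro!: ext P.M.l_neg simp: component_closed)
    qed (auto intro!: ext P.M.a_assoc P.M.a_comm simp: component_closed)
    show "(a \<oplus>\<^bsub>rat_ring\<^esub> b) \<odot>\<^bsub>?S\<^esub> x = a \<odot>\<^bsub>?S\<^esub> x \<oplus>\<^bsub>?S\<^esub> b \<odot>\<^bsub>?S\<^esub> x" if "x \<in> carrier ?S" for a b x
      using that P.smult_l_distr[of a b] by (auto intro!: ext simp: component_closed)
    show "(a \<otimes>\<^bsub>rat_ring\<^esub> b) \<odot>\<^bsub>?S\<^esub> x = a \<odot>\<^bsub>?S\<^esub> (b \<odot>\<^bsub>?S\<^esub> x)" if "x \<in> carrier ?S" for a b x
      using that P.smult_assoc1[of a b] by (auto intro!: ext simp: component_closed)
    show "\<one>\<^bsub>rat_ring\<^esub> \<odot>\<^bsub>?S\<^esub> x = x" if "x \<in> carrier ?S" for x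
      using that P.smult_one by (auto intro!: ext simp: component_closed)
  qed (auto intro!: ext P.smult_r_distr simp: component_closed cring_rat_ring)
qed

text \<open>The test function is evaluated at the variable \<open>x\<^bsub>s p\<^esub>\<close> in the head.\<close>

definition sym_pairing ::
  "(nat \<Rightarrow> 'a \<Rightarrow> (nat \<Rightarrow> rat) \<Rightarrow> rat) \<Rightarrow> nat \<Rightarrow> ((nat \<Rightarrow> nat) \<Rightarrow> 'a) \<Rightarrow> (nat \<Rightarrow> rat) \<Rightarrow> rat" where
  "sym_pairing L n u F = (\<Sum>s\<in>perms n. L n (u s) (F \<circ> s))"

lemma finite_perms: "finite (perms n)"
  by (rule finite_permutations) simp

context head_pairing
begin

lemma sym_pcomp_closed:
  assumes "1 \<le> i" "i \<le> m" "1 \<le> n"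
    "u \<in> carrier (comps (symmetrization P) m)" "v \<in> carrier (comps (symmetrization P) n)"
    "s \<in> perms m" "t \<in> perms n"
  shows "pcomp P m n (inv' s i) (u s) (v t) \<in> carrier (comps P (m + n - 1))"
proof -
  have "inv' s i \<in> {1..m}"
    using assms permutes_in_image[OF permutes_inv, of s "{1..m}" i] by simp
  then show ?thesis
    using assms by (intro pcomp_closed) (auto simp: component_closed)
qed

text \<open>\<^const>\<open>sym_pairing\<close> only sees a sum over all components. Equations between composites themselves
  need the pairings of the single components.\<close>

lemma sym_pcomp_component:
  assumes i: "1 \<le> i" "i \<le> m" "1 \<le> n"
    and u: "u \<in> carrier (comps (symmetrization P) m)" and v: "v \<in> carrier (comps (symmetrization P) n)"
    and \<pi>: "\<pi> \<in> perms (m + n - 1)"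
  shows "L (m + n - 1) (pcomp (symmetrization P) m n i u v \<pi>) F =
    (\<Sum>(s, t)\<in>{(s, t) \<in> perms m \<times> perms n. perm_pcomp m n i s t = \<pi>}.
      L m (u s) (\<lambda>p. L n (v t) (\<lambda>q. F (head_index n (inv' s i) p q))))"
proof -
  interpret mn: functional_family "comps P (m + n - 1)" "L (m + n - 1)"
    using i by (intro functional_family) simp
  have fin: "finite {(s, t) \<in> perms m \<times> perms n. perm_pcomp m n i s t = \<pi>}" (is "finite ?S")
    by (rule finite_subset[OF _ finite_cartesian_product[OF finite_perms[of m] finite_perms[of n]]]) auto
  have "pcomp (symmetrization P) m n i u v \<pi> =
      finsum (comps P (m + n - 1)) (\<lambda>(s, t). pcomp P m n (inv' s i) (u s) (v t)) ?S"
    using \<pi> by (simp add: symmetrization_def)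
  then have "L (m + n - 1) (pcomp (symmetrization P) m n i u v \<pi>) F =
      (\<Sum>x\<in>?S. L (m + n - 1) (case x of (s, t) \<Rightarrow> pcomp P m n (inv' s i) (u s) (v t)) F)"
    by (simp only:) (rule mn.L_finsum[OF fin], auto intro!: sym_pcomp_closed[OF i u v])
  also have "\<dots> = (\<Sum>(s, t)\<in>?S. L m (u s) (\<lambda>p. L n (v t) (\<lambda>q. F (head_index n (inv' s i) p q))))"
  proof (rule sum.cong[OF refl])
    fix x assume "x \<in> ?S"
    then obtain s t where x: "x = (s, t)" and st: "s permutes {1..m}" "t permutes {1..n}" by auto
    have "inv' s i \<in> {1..m}"
      using i permutes_in_image[OF permutes_inv[OF st(1)], of i] by simp
    moreover have "u s \<in> carrier (comps P m)" "v t \<in> carrier (comps P n)"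
      using u v st by (simp_all add: component_closed)
    ultimately show "L (m + n - 1) (case x of (s, t) \<Rightarrow> pcomp P m n (inv' s i) (u s) (v t)) F =
        (case x of (s, t) \<Rightarrow> L m (u s) (\<lambda>p. L n (v t) (\<lambda>q. F (head_index n (inv' s i) p q))))"
      unfolding x prod.case using i by (intro L_pcomp) simp_all
  qed
  finally show ?thesis .
qed

text \<open>Summing over all \<open>\<pi>\<close> merges the fibres of \<open>(s, t) \<mapsto> \<pi>\<close> into a double sum over \<open>s\<close> and \<open>t\<close>, in which head
  variables compose by the rule for head positions.\<close>

lemma sym_pairing_pcomp:
  assumes i: "1 \<le> i" "i \<le> m" "1 \<le> n"
    and u: "u \<in> carrier (comps (symmetrization P) m)" and v: "v \<in> carrier (comps (symmetrization P) n)"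
  shows "sym_pairing L (m + n - 1) (pcomp (symmetrization P) m n i u v) F =
    sym_pairing L m u (\<lambda>p. sym_pairing L n v (\<lambda>q. F (head_index n i p q)))"
proof -
  let ?S = "perms m \<times> perms n" and ?g = "\<lambda>(s, t). perm_pcomp m n i s t"
  let ?T = "\<lambda>(s, t). L m (u s) (\<lambda>p. L n (v t) (\<lambda>q. F (head_index n i (s p) (t q))))"
  have fin: "finite ?S" by (intro finite_cartesian_product finite_perms)
  have "sym_pairing L (m + n - 1) (pcomp (symmetrization P) m n i u v) F =
      (\<Sum>\<pi>\<in>perms (m + n - 1). \<Sum>x\<in>{x \<in> ?S. ?g x = \<pi>}. ?T x)"
    unfolding sym_pairing_def
  proof (rule sum.cong[OF refl])
    fix \<pi> assume \<pi>: "\<pi> \<in> perms (m + n - 1)"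
    have "L (m + n - 1) (pcomp (symmetrization P) m n i u v \<pi>) (F \<circ> \<pi>) =
      (\<Sum>(s, t)\<in>{(s, t) \<in> ?S. perm_pcomp m n i s t = \<pi>}.
        L m (u s) (\<lambda>p. L n (v t) (\<lambda>q. (F \<circ> \<pi>) (head_index n (inv' s i) p q))))"
      by (rule sym_pcomp_component[OF i u v \<pi>])
    also have "\<dots> = (\<Sum>x\<in>{x \<in> ?S. ?g x = \<pi>}. ?T x)"
    proof (rule sum.cong)
      fix x assume "x \<in> {x \<in> ?S. ?g x = \<pi>}"
      then obtain s t where x: "x = (s, t)" "s permutes {1..m}" "t permutes {1..n}"
        "perm_pcomp m n i s t = \<pi>" by auto
      have "u s \<in> carrier (comps P m)" "v t \<in> carrier (comps P n)"
        using u v x by (simp_all add: component_closed)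
      moreover have "(F \<circ> \<pi>) (head_index n (inv' s i) p q) = F (head_index n i (s p) (t q))"
        if "p \<in> {1..m}" "q \<in> {1..n}" for p q
        using perm_pcomp_head_index[OF x(2,3) _ that] i x(4) by auto
      ultimately show "(case x of (s, t) \<Rightarrow>
          L m (u s) (\<lambda>p. L n (v t) (\<lambda>q. (F \<circ> \<pi>) (head_index n (inv' s i) p q)))) = ?T x"
        unfolding x(1) prod.case by (intro L_cong) (use i in auto)
    qed auto
    finally show "L (m + n - 1) (pcomp (symmetrization P) m n i u v \<pi>) (F \<circ> \<pi>) =
      (\<Sum>x\<in>{x \<in> ?S. ?g x = \<pi>}. ?T x)" .
  qed
  also have "\<dots> = (\<Sum>x\<in>?S. ?T x)"
    by (rule sum.group[OF fin finite_perms]) (use i permutes_perm_pcomp in auto)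
  also have "\<dots> = (\<Sum>s\<in>perms m. \<Sum>t\<in>perms n. ?T (s, t))"
    by (simp add: sum.cartesian_product)
  also have "\<dots> = sym_pairing L m u (\<lambda>p. sym_pairing L n v (\<lambda>q. F (head_index n i p q)))"
    by (simp add: sym_pairing_def o_def L_test_sum)
  finally show ?thesis .
qed

lemma head_pairing_symmetrization: "head_pairing (symmetrization P) (sym_pairing L)"
proof (rule head_pairing.intro)
  show "module rat_ring (comps (symmetrization P) n)" if "1 \<le> n" for n
    using comps_module[OF that] by (rule module_symmetrization)
next
  fix i m n :: nat and u v
  assume i: "1 \<le> i" "i \<le> m" "1 \<le> n"
    and u: "u \<in> carrier (comps (symmetrization P) m)" and v: "v \<in> carrier (comps (symmetrization P) n)"
  interpret module rat_ring "comps P (m + n - 1)"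
    using i by (intro comps_module) simp
  show "pcomp (symmetrization P) m n i u v \<in> carrier (comps (symmetrization P) (m + n - 1))"
    using sym_pcomp_closed[OF i u v] by (auto simp: symmetrization_def intro!: M.finsum_closed)
  show "sym_pairing L (m + n - 1) (pcomp (symmetrization P) m n i u v) F =
       sym_pairing L m u (\<lambda>p. sym_pairing L n v (\<lambda>q. F (head_index n i p q)))" for F
    by (rule sym_pairing_pcomp[OF i u v])
next
  show "sym_pairing L n u F = sym_pairing L n u G"
    if "1 \<le> n" "u \<in> carrier (comps (symmetrization P) n)" "\<And>p. p \<in> {1..n} \<Longrightarrow> F p = G p" for n u F G
    unfolding sym_pairing_def
  proof (rule sum.cong[OF refl])
    fix s assume s: "s \<in> perms n"
    show "L n (u s) (F \<circ> s) = L n (u s) (G \<circ> s)"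
      using that s permutes_in_image[of s "{1..n}"] by (intro L_cong) (auto simp: component_closed)
  qed
next
  show "sym_pairing L n u (\<lambda>p. F p + G p) = sym_pairing L n u F + sym_pairing L n u G" for n u F G
    by (simp add: sym_pairing_def o_def L_test_add sum.distrib)
  show "sym_pairing L n u (\<lambda>p. a * F p) = a * sym_pairing L n u F" for n u a F
    by (simp add: sym_pairing_def o_def L_test_scale sum_distrib_left)
next
  fix n :: nat and u v F and a :: rat
  assume n: "1 \<le> n" and u: "u \<in> carrier (comps (symmetrization P) n)"
  show "sym_pairing L n (a \<odot>\<^bsub>comps (symmetrization P) n\<^esub> u) F = a * sym_pairing L n u F"
    unfolding sym_pairing_def sum_distrib_left
    by (rule sum.cong[OF refl]) (use n u in \<open>auto simp: L_smult component_closed\<close>)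
  assume v: "v \<in> carrier (comps (symmetrization P) n)"
  show "sym_pairing L n (u \<oplus>\<^bsub>comps (symmetrization P) n\<^esub> v) F = sym_pairing L n u F + sym_pairing L n v F"
    unfolding sym_pairing_def sum.distrib[symmetric]
    by (rule sum.cong[OF refl]) (use n u v in \<open>auto simp: L_add component_closed\<close>)
qed

end

lemma sact_symmetrization_closed:
  assumes "\<sigma> permutes {1..n}" "u \<in> carrier (comps (symmetrization P) n)"
  shows "sact (symmetrization P) n \<sigma> u \<in> carrier (comps (symmetrization P) n)"
  using assms permutes_compose[OF _ permutes_inv, of _ "{1..n}" \<sigma>] by (auto simp: component_closed)

text \<open>Renaming the variables by \<open>\<sigma>\<close> renames the variable in the head.\<close>

lemma sym_pairing_sact:
  assumes \<sigma>: "\<sigma> permutes {1..n}"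
  shows "sym_pairing L n (sact (symmetrization P) n \<sigma> u) F = sym_pairing L n u (F \<circ> \<sigma>)"
  unfolding sym_pairing_def
proof (rule sum.reindex_bij_witness[of _ "\<lambda>s. \<sigma> \<circ> s" "\<lambda>s. inv' \<sigma> \<circ> s"])
  fix s assume s: "s \<in> perms n"
  show "\<sigma> \<circ> (inv' \<sigma> \<circ> s) = s" "inv' \<sigma> \<circ> (\<sigma> \<circ> s) = s"
    using permutes_inv_o[OF \<sigma>] by (simp_all add: o_assoc)
  show "inv' \<sigma> \<circ> s \<in> perms n" "\<sigma> \<circ> s \<in> perms n"
    using s \<sigma> by (simp_all add: permutes_compose permutes_inv)
  have "F \<circ> \<sigma> \<circ> (inv' \<sigma> \<circ> s) = F \<circ> s"
    by (simp add: fun_eq_iff permutes_inverses[OF \<sigma>])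
  then show "L n (u (inv' \<sigma> \<circ> s)) (F \<circ> \<sigma> \<circ> (inv' \<sigma> \<circ> s)) =
      L n (sact (symmetrization P) n \<sigma> u s) (F \<circ> s)"
    using s by simp
qed

lemma (in head_pairing) operad_ideal_symmetrization:
  "operad_ideal (symmetrization P) (\<lambda>n. annihilated (comps (symmetrization P) n) (sym_pairing L n))"
  unfolding operad_ideal_def
  using head_pairing.ns_ideal_annihilated[OF head_pairing_symmetrization]
    sact_symmetrization_closed[of _ _ _ P] sym_pairing_sact[of _ _ L P]
  by (auto simp: annihilated_def simp del: symmetrization_simps)

section \<open>The anticyclic structure of Dias\<close>

definition dias_pairing :: "(dias_op tree \<Rightarrow>\<^sub>0 rat) set \<Rightarrow> (nat \<Rightarrow> rat) \<Rightarrow> rat" where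
  "dias_pairing = on_cosets free_pairing"

interpretation free: head_pairing free_nsoperad "\<lambda>_. free_pairing"
  by (rule head_pairing_free)

interpretation Dias: head_pairing Dias "\<lambda>_. dias_pairing"
  unfolding Dias_def dias_pairing_def
  by (rule free.quotient) (rule dias_ideal_eq)

lemma comps_Dias:
  "1 \<le> n \<Longrightarrow> comps Dias n =
    quot_module (comps free_nsoperad n) (annihilated (comps free_nsoperad n) free_pairing)"
  by (simp add: Dias_def quot_nsoperad_def dias_ideal_eq)

lemma dias_eqI:
  assumes "1 \<le> n" "X \<in> carrier (comps Dias n)" "Y \<in> carrier (comps Dias n)"
    and "\<And>F. dias_pairing X F = dias_pairing Y F"
  shows "X = Y"
  using functional_family.quot_eq_iff[OF free.functional_family[OF assms(1)], of X Y] assms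
  by (simp add: comps_Dias dias_pairing_def fun_eq_iff)

definition dias_tree :: "dias_op tree \<Rightarrow> (dias_op tree \<Rightarrow>\<^sub>0 rat) set" where
  "dias_tree t = quot_proj free_nsoperad dias_ideal (size1 t) (basis_vec t)"

lemma dias_tree_closed: "size1 t = n \<Longrightarrow> dias_tree t \<in> carrier (comps Dias n)"
  using functional_family.quot_closed[OF free.functional_family, of n "basis_vec t"] one_le_size1[of t]
  by (auto simp: comps_Dias dias_tree_def quot_proj_def dias_ideal_eq)

lemma dias_pairing_tree [simp]: "dias_pairing (dias_tree t) F = F (head t)"
  using functional_family.on_cosets_coset[OF free.functional_family, of "size1 t" "basis_vec t"]
    one_le_size1[of t]
  by (simp add: dias_pairing_def dias_tree_def quot_proj_def dias_ideal_eq) (simp add: free_pairing_def)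

lemma dias_gen_eq: "dias_gen a = dias_tree \<langle>\<langle>\<rangle>, a, \<langle>\<rangle>\<rangle>"
  by (simp add: dias_gen_def dias_tree_def)

lemma dias_gen_closed: "dias_gen a \<in> carrier (comps Dias 2)"
  by (simp add: dias_gen_eq dias_tree_closed)

lemma dias_pairing_gen [simp]:
  "dias_pairing (dias_gen \<stileturn>) F = F 1" "dias_pairing (dias_gen \<turnstile>) F = F 2"
  by (simp_all add: dias_gen_eq)

lemma dias_induct [consumes 2, case_names tree add smult]:
  assumes n: "1 \<le> n" and X: "X \<in> carrier (comps Dias n)"
    and tree: "\<And>t. size1 t = n \<Longrightarrow> Q (dias_tree t)"
    and add: "\<And>X Y. \<lbrakk>X \<in> carrier (comps Dias n); Y \<in> carrier (comps Dias n); Q X; Q Y\<rbrakk> \<Longrightarrow>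
      Q (X \<oplus>\<^bsub>comps Dias n\<^esub> Y)"
    and smult: "\<And>a X. \<lbrakk>X \<in> carrier (comps Dias n); Q X\<rbrakk> \<Longrightarrow> Q (a \<odot>\<^bsub>comps Dias n\<^esub> X)"
  shows "Q X"
proof -
  interpret F: functional_family "comps free_nsoperad n" free_pairing
    by (rule free.functional_family[OF n])
  let ?proj = "\<lambda>f. annihilated (comps free_nsoperad n) free_pairing +>\<^bsub>comps free_nsoperad n\<^esub> f"
  have tree': "Q (?proj (basis_vec t))" if "size1 t = n" for t
    using tree[OF that] that n by (simp add: dias_tree_def quot_proj_def dias_ideal_eq)
  have closed: "?proj f \<in> carrier (comps Dias n)" if "f \<in> carrier (comps free_nsoperad n)" for f
    using that n by (simp only: comps_Dias F.quot_closed)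
  obtain f where f: "f \<in> carrier (comps free_nsoperad n)" "X = ?proj f"
    using X n by (auto simp only: comps_Dias elim: F.quot_cases)
  \<comment> \<open>Build \<open>f\<close> up monomial by monomial; the empty sum is zero times a monomial.\<close>
  let ?part = "\<lambda>S. \<Sum>t\<in>S. Poly_Mapping.map ((*) (Poly_Mapping.lookup f t)) (basis_vec t)"
  have scaled: "Q (?proj (Poly_Mapping.map ((*) a) (basis_vec t)))" if "size1 t = n" for a t
    using smult[OF closed tree'[OF that], of a] that n F.quot_smult[of "basis_vec t" a]
    by (simp add: comps_Dias)
  have "?part S \<in> carrier (comps free_nsoperad n) \<and> Q (?proj (?part S))"
    if "S \<subseteq> Poly_Mapping.keys f" for S
    using finite_subset[OF that finite_keys] that
  proof (induction S rule: finite_induct)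
    case empty
    show ?case using scaled[of "normal_tree n 1" 0] n by (simp add: size1_normal_tree)
  next
    case (insert t S)
    then have t: "size1 t = n" using f(1) by auto
    let ?b = "Poly_Mapping.map ((*) (Poly_Mapping.lookup f t)) (basis_vec t)"
    have b: "?b \<in> carrier (comps free_nsoperad n)" using t by simp
    have S: "?part S \<in> carrier (comps free_nsoperad n)" "Q (?proj (?part S))"
      using insert by blast+
    have "?proj (?part (insert t S)) = ?proj ?b \<oplus>\<^bsub>comps Dias n\<^esub> ?proj (?part S)"
      using insert F.quot_add[OF b S(1)] n by (simp add: comps_Dias del: map_single)
    then have "Q (?proj (?part (insert t S)))"
      using add[OF closed[OF b] closed[OF S(1)] scaled[OF t] S(2)] by simp
    moreover have "?part (insert t S) \<in> carrier (comps free_nsoperad n)"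
      using insert F.M.a_closed[OF b S(1)] by (simp del: map_single)
    ultimately show ?case by blast
  qed
  from this[OF order_refl] have "Q (?proj (?part (Poly_Mapping.keys f)))" ..
  moreover have "?part (Poly_Mapping.keys f) = f"
    by (rule linext_eqI) (simp add: linext_def[of _ f])
  ultimately show "Q X" by (simp only: f(2))
qed

lemma anticyclic_identity_later_input:
  assumes "anticyclic_identities P \<tau>" "1 \<le> n" "2 \<le> i" "i \<le> m"
    "f \<in> carrier (comps P m)" "g \<in> carrier (comps P n)"
  shows "\<tau> (m + n - 1) (pcomp P m n i f g) = pcomp P m n (i - 1) (\<tau> m f) g"
  using assms by (simp add: anticyclic_identities_def)

text \<open>On the basis element \<open>e\<^sub>p\<close> with head \<open>p\<close> this says \<open>\<tau> e\<^sub>1 = - e\<^sub>n\<close> and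
  \<open>\<tau> e\<^sub>p = e\<^bsub>p-1\<^esub> - e\<^sub>n\<close> for \<open>p \<ge> 2\<close>, in the form suited to \<open>e\<^sub>p \<mapsto> \<epsilon>\<^sub>p - \<epsilon>\<^bsub>n+1\<^esub>\<close>. For
  \<open>n \<ge> 2\<close> every \<open>e\<^sub>p\<close> is \<open>g \<circ>\<^sub>2 G\<close> with a generator \<open>g\<close> and some \<open>G\<close> of arity \<open>n - 1\<close>; then
  \<open>\<tau>(g \<circ>\<^sub>2 G) = \<tau>(g) \<circ>\<^sub>1 G\<close> reduces the computation to the given values of \<open>\<tau>\<close> on generators.\<close>

lemma dias_anticyclic_pairing:
  assumes \<tau>: "dias_anticyclic \<tau>" and n: "1 \<le> n" and X: "X \<in> carrier (comps Dias n)"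
  shows "dias_pairing (\<tau> n X) (\<lambda>p. F p - F (n + 1)) =
    dias_pairing X (\<lambda>p. F (long_cycle n p) - F (long_cycle n (n + 1)))"
  using n X
proof (induction rule: dias_induct)
  interpret \<tau>: ns_anticyclic_operad Dias \<tau>
    using \<tau> by (simp add: dias_anticyclic_def)
  interpret V: functional_family "comps Dias n" dias_pairing
    by (rule Dias.functional_family[OF n])
  have lin: "\<tau> n \<in> linear_maps (comps Dias n) (comps Dias n)"
    by (rule \<tau>.\<tau>_linear[OF n])
  then have closed: "\<tau> n Y \<in> carrier (comps Dias n)" if "Y \<in> carrier (comps Dias n)" for Y
    using that by (auto simp: linear_maps_def)
  {
    case (add X Y)
    moreover have "\<tau> n (X \<oplus>\<^bsub>comps Dias n\<^esub> Y) = \<tau> n X \<oplus>\<^bsub>comps Dias n\<^esub> \<tau> n Y"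
      using lin add by (simp add: linear_maps_def)
    ultimately show ?case by (simp add: V.L_add closed)
  next
    case (smult a X)
    moreover have "\<tau> n (a \<odot>\<^bsub>comps Dias n\<^esub> X) = a \<odot>\<^bsub>comps Dias n\<^esub> \<tau> n X"
      using lin smult by (simp add: linear_maps_def)
    ultimately show ?case by (simp add: V.L_smult closed)
  next
    case (tree t)
    show ?case
    proof (cases "n = 1")
      case True
      then have "\<tau> n (dias_tree t) = \<ominus>\<^bsub>comps Dias n\<^esub> dias_tree t"
        using \<tau> dias_tree_closed[OF tree] by (simp add: dias_anticyclic_def)
      then have "dias_pairing (\<tau> n (dias_tree t)) H = - H (head t)" for H
        using V.L_minus[OF dias_tree_closed[OF tree]] by simp
      moreover have "head t = 1"
        using head_bounds[of t] tree True by simp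
      ultimately show ?thesis
        using True by (simp add: long_cycle_def One_nat_def)
    next
      case False
      define k where "k = n - 1"
      have k: "1 \<le> k" "n = 2 + k - 1" "n = k + 1" using False n by (auto simp: k_def)
      interpret V2: functional_family "comps Dias 2" dias_pairing
        by (rule Dias.functional_family) simp
      have \<tau>2: "\<tau> 2 (dias_gen \<stileturn>) = \<ominus>\<^bsub>comps Dias 2\<^esub> dias_gen \<turnstile>"
        "\<tau> 2 (dias_gen \<turnstile>) = dias_gen \<stileturn> \<ominus>\<^bsub>comps Dias 2\<^esub> dias_gen \<turnstile>"
        using \<tau> by (simp_all add: dias_anticyclic_def)
      \<comment> \<open>In \<open>x \<stileturn> y\<close> any \<open>G\<close> may be put for \<open>y\<close>; in \<open>x \<turnstile> y\<close> its head becomes the head.\<close>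
      define G where "G = dias_tree (normal_tree k (if head t = 1 then 1 else head t - 1))"
      define g where "g = dias_gen (if head t = 1 then \<stileturn> else \<turnstile>)"
      have h: "1 \<le> head t" "head t \<le> n"
        using head_bounds[of t] tree by simp_all
      have hk: "(if head t = 1 then 1 else head t - 1) \<in> {1..k}"
        using h k by auto
      have G: "G \<in> carrier (comps Dias k)"
        unfolding G_def by (intro dias_tree_closed size1_normal_tree hk)
      have LG: "dias_pairing G H = H (if head t = 1 then 1 else head t - 1)" for H
        unfolding G_def dias_pairing_tree head_normal_tree[OF hk] ..
      have g: "g \<in> carrier (comps Dias 2)"
        by (simp add: g_def dias_gen_closed)
      have \<tau>g: "\<tau> 2 g \<in> carrier (comps Dias 2)"
        using \<tau>.\<tau>_linear[of 2] g by (auto simp: linear_maps_def)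
      have L\<tau>g: "dias_pairing (\<tau> 2 g) H = (if head t = 1 then - H 2 else H 1 - H 2)" for H
        by (simp add: g_def \<tau>2 V2.L_minus V2.L_diff dias_gen_closed)
      have "dias_tree t = pcomp Dias 2 k 2 g G"
      proof (rule dias_eqI[OF n])
        show "dias_tree t \<in> carrier (comps Dias n)"
          by (rule dias_tree_closed[OF tree])
        show "pcomp Dias 2 k 2 g G \<in> carrier (comps Dias n)"
          using Dias.pcomp_closed[of 2 2 k g G] k(1) g G by (simp add: k(2))
        show "dias_pairing (dias_tree t) H = dias_pairing (pcomp Dias 2 k 2 g G) H" for H
          using Dias.L_pcomp[of 2 2 k g G H] k(1) g G h by (simp add: LG) (simp add: g_def head_index_def)
      qed
      moreover have "\<tau> n (pcomp Dias 2 k 2 g G) = pcomp Dias 2 k 1 (\<tau> 2 g) G"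
        using anticyclic_identity_later_input[OF \<tau>.identities, of k 2 2 g G] k(1) g G
        by (simp add: k(2) One_nat_def)
      ultimately have "dias_pairing (\<tau> n (dias_tree t)) H =
          dias_pairing (\<tau> 2 g) (\<lambda>p. dias_pairing G (\<lambda>q. H (head_index k 1 p q)))" for H
        using Dias.L_pcomp[of 1 2 k "\<tau> 2 g" G H] k(1) \<tau>g G by simp
      then have "dias_pairing (\<tau> n (dias_tree t)) H =
          (if head t = 1 then - H n else H (head t - 1) - H n)" for H
        using h(1) by (simp add: L\<tau>g LG head_index_def k(2))
      moreover have "long_cycle n (n + 1) = n" "long_cycle n (head t) = (if head t = 1 then n + 1 else head t - 1)"
        using h n by (auto simp: long_cycle_def)
      ultimately show ?thesis
        by simp
    qed
  }
qed

lemma dias_anticyclic_pairing_funpow: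
  assumes \<tau>: "dias_anticyclic \<tau>" and n: "1 \<le> n" and X: "X \<in> carrier (comps Dias n)"
  shows "(\<tau> n ^^ k) X \<in> carrier (comps Dias n) \<and>
    dias_pairing ((\<tau> n ^^ k) X) (\<lambda>p. F p - F (n + 1)) =
    dias_pairing X (\<lambda>p. F ((long_cycle n ^^ k) p) - F ((long_cycle n ^^ k) (n + 1)))"
proof (induction k arbitrary: F)
  case (Suc k)
  have "\<tau> n \<in> linear_maps (comps Dias n) (comps Dias n)"
    using \<tau> n ns_anticyclic_operad.\<tau>_linear[of Dias \<tau> n] by (simp add: dias_anticyclic_def)
  then have "\<tau> n ((\<tau> n ^^ k) X) \<in> carrier (comps Dias n)"
    using Suc by (auto simp: linear_maps_def)
  then show ?case
    using dias_anticyclic_pairing[OF \<tau> n, of "(\<tau> n ^^ k) X" F] Suc[of "F \<circ> long_cycle n"] by simp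
qed (use X in simp)

section \<open>Pure tensors and the relation of Perm\<close>

text \<open>From here on, elements of the symmetrization are handled through the pairings of their components.\<close>

declare symmetrization_simps [simp del]

abbreviation symdias_pairing :: "nat \<Rightarrow> ((nat \<Rightarrow> nat) \<Rightarrow> (dias_op tree \<Rightarrow>\<^sub>0 rat) set) \<Rightarrow> (nat \<Rightarrow> rat) \<Rightarrow> rat"
  where "symdias_pairing \<equiv> sym_pairing (\<lambda>_. dias_pairing)"

interpretation SymDias: head_pairing SymDias symdias_pairing
  by (rule Dias.head_pairing_symmetrization)

lemma component_family:
  assumes "1 \<le> n" "r \<in> perms n"
  shows "functional_family (comps SymDias n) (\<lambda>u. dias_pairing (u r))"
proof (intro functional_family.intro functional_family_axioms.intro)
  show "module rat_ring (comps SymDias n)"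
    by (rule SymDias.comps_module[OF assms(1)])
qed (use assms in \<open>auto simp: symmetrization_simps Dias.L_add[where n = n] Dias.L_smult[where n = n] component_closed\<close>)

text \<open>Elements of \<^const>\<open>Dias\<close> are separated by the pairing, so elements of its symmetrization are
  separated by the pairings of their components.\<close>

lemma symdias_eqI:
  assumes "1 \<le> n" "u \<in> carrier (comps SymDias n)" "v \<in> carrier (comps SymDias n)"
    and "\<And>r F. r \<in> perms n \<Longrightarrow> dias_pairing (u r) F = dias_pairing (v r) F"
  shows "u = v"
proof (rule PiE_ext)
  show "u \<in> perms n \<rightarrow>\<^sub>E carrier (comps Dias n)" "v \<in> perms n \<rightarrow>\<^sub>E carrier (comps Dias n)"
    using assms by (simp_all add: symmetrization_simps)
  then show "u r = v r" if "r \<in> perms n" for r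
    using assms(1,4) that by (intro dias_eqI[of n]) (auto simp: component_closed)
qed

lemma pure_tensor_closed:
  assumes "1 \<le> n" "X \<in> carrier (comps Dias n)"
  shows "pure_tensor Dias n X s \<in> carrier (comps SymDias n)"
proof -
  interpret functional_family "comps Dias n" dias_pairing
    by (rule Dias.functional_family[OF assms(1)])
  show ?thesis using assms by (auto simp: pure_tensor_def symmetrization_simps)
qed

lemma pure_tensor_component:
  assumes "1 \<le> n" "r \<in> perms n"
  shows "dias_pairing (pure_tensor Dias n X s r) F = (if r = s then dias_pairing X F else 0)"
proof -
  interpret functional_family "comps Dias n" dias_pairing
    by (rule Dias.functional_family[OF assms(1)])
  show ?thesis using assms by (simp add: pure_tensor_def L_zero)
qed

lemma component_add:
  "\<lbrakk>1 \<le> n; r \<in> perms n; u \<in> carrier (comps SymDias n); v \<in> carrier (comps SymDias n)\<rbrakk> \<Longrightarrow>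
   dias_pairing ((u \<oplus>\<^bsub>comps SymDias n\<^esub> v) r) F = dias_pairing (u r) F + dias_pairing (v r) F"
  by (rule functional_family.L_add[OF component_family])

lemma component_diff:
  "\<lbrakk>1 \<le> n; r \<in> perms n; u \<in> carrier (comps SymDias n); v \<in> carrier (comps SymDias n)\<rbrakk> \<Longrightarrow>
   dias_pairing ((u \<ominus>\<^bsub>comps SymDias n\<^esub> v) r) F = dias_pairing (u r) F - dias_pairing (v r) F"
  by (rule functional_family.L_diff[OF component_family])

lemma component_smult:
  "\<lbrakk>1 \<le> n; r \<in> perms n; u \<in> carrier (comps SymDias n)\<rbrakk> \<Longrightarrow>
   dias_pairing ((a \<odot>\<^bsub>comps SymDias n\<^esub> u) r) F = a * dias_pairing (u r) F"
  by (rule functional_family.L_smult[OF component_family])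

lemma pure_tensor_add:
  assumes n: "1 \<le> n" and "X \<in> carrier (comps Dias n)" "Y \<in> carrier (comps Dias n)"
  shows "pure_tensor Dias n (X \<oplus>\<^bsub>comps Dias n\<^esub> Y) s =
    pure_tensor Dias n X s \<oplus>\<^bsub>comps SymDias n\<^esub> pure_tensor Dias n Y s"
proof -
  interpret M: module rat_ring "comps SymDias n" by (rule SymDias.comps_module[OF n])
  interpret D: module rat_ring "comps Dias n" by (rule Dias.comps_module[OF n])
  show ?thesis
    using assms by (intro symdias_eqI[OF n])
      (simp_all add: pure_tensor_closed n component_add pure_tensor_component Dias.L_add[OF n])
qed

lemma pure_tensor_smult:
  assumes n: "1 \<le> n" and "X \<in> carrier (comps Dias n)"
  shows "pure_tensor Dias n (a \<odot>\<^bsub>comps Dias n\<^esub> X) s = a \<odot>\<^bsub>comps SymDias n\<^esub> pure_tensor Dias n X s"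
proof -
  interpret M: module rat_ring "comps SymDias n" by (rule SymDias.comps_module[OF n])
  interpret D: module rat_ring "comps Dias n" by (rule Dias.comps_module[OF n])
  have "a \<odot>\<^bsub>comps Dias n\<^esub> X \<in> carrier (comps Dias n)"
    "a \<odot>\<^bsub>comps SymDias n\<^esub> pure_tensor Dias n X s \<in> carrier (comps SymDias n)"
    using assms by (simp_all add: D.smult_closed M.smult_closed pure_tensor_closed n)
  with assms show ?thesis
    by (intro symdias_eqI[OF n])
      (simp_all add: pure_tensor_closed n component_smult pure_tensor_component Dias.L_smult[OF n])
qed

lemma symdias_pairing_pure_tensor:
  assumes "1 \<le> n" "s \<in> perms n"
  shows "symdias_pairing n (pure_tensor Dias n X s) F = dias_pairing X (F \<circ> s)"
proof -
  have "symdias_pairing n (pure_tensor Dias n X s) F =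
      (\<Sum>r\<in>perms n. if r = s then dias_pairing X (F \<circ> r) else 0)"
    unfolding sym_pairing_def by (rule sum.cong) (simp_all add: pure_tensor_component assms(1))
  then show ?thesis
    using assms by (simp add: finite_perms)
qed

lemma sact_pure_tensor:
  assumes n: "1 \<le> n" and X: "X \<in> carrier (comps Dias n)" and \<sigma>: "\<sigma> permutes {1..n}" and s: "s permutes {1..n}"
  shows "sact SymDias n \<sigma> (pure_tensor Dias n X s) = pure_tensor Dias n X (\<sigma> \<circ> s)"
proof (rule symdias_eqI[OF n])
  show "sact SymDias n \<sigma> (pure_tensor Dias n X s) \<in> carrier (comps SymDias n)"
    by (intro sact_symmetrization_closed \<sigma> pure_tensor_closed n X)
  show "pure_tensor Dias n X (\<sigma> \<circ> s) \<in> carrier (comps SymDias n)"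
    by (intro pure_tensor_closed n X)
  fix r F assume r: "r \<in> perms n"
  have "inv' \<sigma> \<circ> r = s \<longleftrightarrow> r = \<sigma> \<circ> s"
    using permutes_inverses[OF \<sigma>] by (auto simp: fun_eq_iff) (metis)
  moreover have "inv' \<sigma> \<circ> r \<in> perms n"
    using r \<sigma> by (simp add: permutes_compose permutes_inv)
  ultimately show "dias_pairing (sact SymDias n \<sigma> (pure_tensor Dias n X s) r) F =
      dias_pairing (pure_tensor Dias n X (\<sigma> \<circ> s) r) F"
    using r by (simp add: symmetrization_simps pure_tensor_component n)
qed

definition perm_relation :: "(nat \<Rightarrow> nat) \<Rightarrow> (dias_op tree \<Rightarrow>\<^sub>0 rat) set" where
  "perm_relation = pure_tensor Dias 2 (dias_gen \<stileturn>) id \<ominus>\<^bsub>comps SymDias 2\<^esub>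
    pure_tensor Dias 2 (dias_gen \<turnstile>) (transpose 1 2)"

lemma perm_relations_eq: "perm_relations n = (if n = 2 then {perm_relation} else {})"
  by (simp add: perm_relations_def perm_relation_def)

lemma transpose_12: "transpose 1 2 \<in> perms 2" "transpose (1::nat) 2 \<noteq> id"
  by (simp_all add: permutes_swap_id) (metis id_apply numeral_eq_one_iff semiring_norm(85) transpose_apply_first)

lemma perm_relation_closed: "perm_relation \<in> carrier (comps SymDias 2)"
proof -
  interpret module rat_ring "comps SymDias 2"
    by (rule SymDias.comps_module) simp
  show ?thesis
    unfolding perm_relation_def by (intro M.minus_closed pure_tensor_closed dias_gen_closed) simp_all
qed

lemma perm_relation_component:
  assumes "t \<in> perms 2"
  shows "dias_pairing (perm_relation t) F =
    (if t = id then F 1 else 0) - (if t = transpose 1 2 then F 2 else 0)"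
proof -
  interpret functional_family "comps SymDias 2" "\<lambda>u. dias_pairing (u t)"
    by (rule component_family) (use assms in simp_all)
  show ?thesis
    using assms by (simp add: perm_relation_def L_diff pure_tensor_closed dias_gen_closed pure_tensor_component)
qed

lemma perm_pcomp_id_id: "\<lbrakk>1 \<le> i; i \<le> m\<rbrakk> \<Longrightarrow> perm_pcomp m 2 i id id = id"
  by (auto simp: perm_pcomp_def Let_def fun_eq_iff)

lemma perm_pcomp_id_transpose:
  "\<lbrakk>1 \<le> i; i \<le> m\<rbrakk> \<Longrightarrow> perm_pcomp m 2 i id (transpose 1 2) = transpose i (i + 1)"
  by (auto simp: perm_pcomp_def Let_def fun_eq_iff transpose_def)

text \<open>Substituting the relation \<open>x\<^sub>1 \<stileturn> x\<^sub>2 = x\<^sub>2 \<turnstile> x\<^sub>1\<close> for the variable \<open>x\<^sub>i\<close> of \<open>X\<close>. In the second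
  term the variables \<open>x\<^sub>i\<close> and \<open>x\<^bsub>i+1\<^esub>\<close> change places.\<close>

lemma pcomp_perm_relation:
  assumes i: "1 \<le> i" "i \<le> m" and X: "X \<in> carrier (comps Dias m)"
  shows "pcomp SymDias m 2 i (pure_tensor Dias m X id) perm_relation =
    pure_tensor Dias (m + 1) (pcomp Dias m 2 i X (dias_gen \<stileturn>)) id \<ominus>\<^bsub>comps SymDias (m + 1)\<^esub>
    pure_tensor Dias (m + 1) (pcomp Dias m 2 i X (dias_gen \<turnstile>)) (transpose i (i + 1))"
proof -
  have m: "m + 2 - 1 = m + 1" "1 \<le> m" "1 \<le> m + 1" using i by simp_all
  interpret M: module rat_ring "comps SymDias (m + 1)"
    by (rule SymDias.comps_module[OF m(3)])
  have closed: "pcomp Dias m 2 i X (dias_gen a) \<in> carrier (comps Dias (m + 1))" for a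
    by (rule Dias.pcomp_closed[OF i _ X dias_gen_closed, unfolded m(1)]) simp
  have pure_closed: "pure_tensor Dias (m + 1) (pcomp Dias m 2 i X (dias_gen a)) s \<in> carrier (comps SymDias (m + 1))" for a s
    by (rule pure_tensor_closed[OF m(3) closed])
  have X_closed: "pure_tensor Dias m X id \<in> carrier (comps SymDias m)"
    by (rule pure_tensor_closed[OF m(2) X])
  show ?thesis
  proof (rule symdias_eqI[OF m(3)])
    show "pcomp SymDias m 2 i (pure_tensor Dias m X id) perm_relation \<in> carrier (comps SymDias (m + 1))"
      by (rule SymDias.pcomp_closed[OF i _ X_closed perm_relation_closed, unfolded m(1)]) simp
    show "pure_tensor Dias (m + 1) (pcomp Dias m 2 i X (dias_gen \<stileturn>)) id \<ominus>\<^bsub>comps SymDias (m + 1)\<^esub>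
        pure_tensor Dias (m + 1) (pcomp Dias m 2 i X (dias_gen \<turnstile>)) (transpose i (i + 1))
        \<in> carrier (comps SymDias (m + 1))"
      by (intro M.minus_closed pure_closed)
    fix \<pi> F assume \<pi>: "\<pi> \<in> perms (m + 1)"
    interpret component: functional_family "comps SymDias (m + 1)" "\<lambda>u. dias_pairing (u \<pi>)"
      by (rule component_family[OF m(3) \<pi>])
    let ?S = "perms m \<times> perms 2" and ?w = "transpose (1::nat) 2"
    let ?T = "\<lambda>(s, t). if perm_pcomp m 2 i s t = \<pi> then dias_pairing (pure_tensor Dias m X id s)
        (\<lambda>p. dias_pairing (perm_relation t) (\<lambda>q. F (head_index 2 (inv' s i) p q))) else 0"
    have T: "?T (s, t) = (if s = id \<and> perm_pcomp m 2 i id t = \<pi> then dias_pairing X (\<lambda>p.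
        (if t = id then F (head_index 2 i p 1) else 0) - (if t = ?w then F (head_index 2 i p 2) else 0)) else 0)"
      if "s \<in> perms m" "t \<in> perms 2" for s t
      using that by (simp add: pure_tensor_component m perm_relation_component)
    have fin: "finite ?S" by (intro finite_cartesian_product finite_perms)
    have "dias_pairing (pcomp SymDias m 2 i (pure_tensor Dias m X id) perm_relation \<pi>) F =
        (\<Sum>(s, t)\<in>{x \<in> ?S. (\<lambda>(s, t). perm_pcomp m 2 i s t = \<pi>) x}. dias_pairing (pure_tensor Dias m X id s)
          (\<lambda>p. dias_pairing (perm_relation t) (\<lambda>q. F (head_index 2 (inv' s i) p q))))"
      using Dias.sym_pcomp_component[OF i _ X_closed perm_relation_closed, of \<pi> F, unfolded m(1)] \<pi>
      by (simp add: case_prod_beta' mem_Times_iff)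
    also have "\<dots> = (\<Sum>x\<in>?S. ?T x)"
      by (subst sum.inter_filter[OF fin]) (auto intro!: sum.cong)
    also have "\<dots> = (\<Sum>x\<in>{(id, id), (id, ?w)}. ?T x)"
    proof (rule sum.mono_neutral_right[OF fin])
      show "{(id, id), (id, ?w)} \<subseteq> ?S"
        using transpose_12(1) by (simp add: permutes_id)
      show "\<forall>x\<in>?S - {(id, id), (id, ?w)}. ?T x = 0"
      proof
        fix x assume x: "x \<in> ?S - {(id, id), (id, ?w)}"
        obtain s t where st: "x = (s, t)" by (cases x)
        with x have "s \<in> perms m" "t \<in> perms 2" "s \<noteq> id \<or> (t \<noteq> id \<and> t \<noteq> ?w)" by auto
        then show "?T x = 0"
          unfolding st T[OF \<open>s \<in> perms m\<close> \<open>t \<in> perms 2\<close>] by (auto simp: Dias.L_test_zero)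
      qed
    qed
    also have "\<dots> = ?T (id, id) + ?T (id, ?w)"
      using transpose_12(2) by simp
    also have "\<dots> = (if \<pi> = id then dias_pairing X (\<lambda>p. F (head_index 2 i p 1)) else 0) -
        (if \<pi> = transpose i (i + 1) then dias_pairing X (\<lambda>p. F (head_index 2 i p 2)) else 0)"
      using transpose_12 T[of id id] T[of id ?w] i Dias.L_test_scale[of X "-1"]
      by (auto simp: permutes_id perm_pcomp_id_id perm_pcomp_id_transpose)
    also have "\<dots> = dias_pairing ((pure_tensor Dias (m + 1) (pcomp Dias m 2 i X (dias_gen \<stileturn>)) id
        \<ominus>\<^bsub>comps SymDias (m + 1)\<^esub>
        pure_tensor Dias (m + 1) (pcomp Dias m 2 i X (dias_gen \<turnstile>)) (transpose i (i + 1))) \<pi>) F"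
      using i by (simp add: component.L_diff pure_closed pure_tensor_component[OF m(3) \<pi>]
          Dias.L_pcomp[OF _ _ _ X dias_gen_closed, unfolded m(1)])
    finally show "dias_pairing (pcomp SymDias m 2 i (pure_tensor Dias m X id) perm_relation \<pi>) F = 
        dias_pairing ((pure_tensor Dias (m + 1) (pcomp Dias m 2 i X (dias_gen \<stileturn>)) id
        \<ominus>\<^bsub>comps SymDias (m + 1)\<^esub>
        pure_tensor Dias (m + 1) (pcomp Dias m 2 i X (dias_gen \<turnstile>)) (transpose i (i + 1))) \<pi>) F" .
  qed
qed

section \<open>The ideal defining Perm\<close>

text \<open>An arbitrary ideal containing the relation of Perm. The aim is to show that it contains every element
  annihilated by the pairing.\<close>

locale perm_ideal_above =
  fixes I :: "nat \<Rightarrow> ((nat \<Rightarrow> nat) \<Rightarrow> (dias_op tree \<Rightarrow>\<^sub>0 rat) set) set"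
  assumes ideal: "operad_ideal SymDias I"
    and relations: "\<And>k. 1 \<le> k \<Longrightarrow> perm_relations k \<subseteq> I k"
begin

lemma
  assumes n: "1 \<le> n"
  shows I_subset: "I n \<subseteq> carrier (comps SymDias n)"
    and I_minus: "u \<in> I n \<Longrightarrow> \<ominus>\<^bsub>comps SymDias n\<^esub> u \<in> I n"
    and I_smult: "u \<in> I n \<Longrightarrow> a \<odot>\<^bsub>comps SymDias n\<^esub> u \<in> I n"
    and I_add: "\<lbrakk>u \<in> I n; v \<in> I n\<rbrakk> \<Longrightarrow> u \<oplus>\<^bsub>comps SymDias n\<^esub> v \<in> I n"
    and I_zero: "\<zero>\<^bsub>comps SymDias n\<^esub> \<in> I n"
proof -
  interpret M: module rat_ring "comps SymDias n" by (rule SymDias.comps_module[OF n])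
  have sub: "submodule (I n) rat_ring (comps SymDias n)"
    using ideal n by (simp add: operad_ideal_def ns_ideal_def)
  note E = M.submoduleE[OF sub]
  show "I n \<subseteq> carrier (comps SymDias n)" by (rule E(1))
  show "u \<in> I n \<Longrightarrow> \<ominus>\<^bsub>comps SymDias n\<^esub> u \<in> I n" for u by (rule E(3))
  show smult: "u \<in> I n \<Longrightarrow> a \<odot>\<^bsub>comps SymDias n\<^esub> u \<in> I n" for a u by (rule E(4)) simp_all
  show "\<lbrakk>u \<in> I n; v \<in> I n\<rbrakk> \<Longrightarrow> u \<oplus>\<^bsub>comps SymDias n\<^esub> v \<in> I n" for u v by (rule E(5))
  obtain u where u: "u \<in> I n" using E(2) by auto
  have "0 \<odot>\<^bsub>comps SymDias n\<^esub> u = \<zero>\<^bsub>comps SymDias n\<^esub>"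
    using M.smult_l_null[of u] u E(1) by auto
  with smult[OF u, of 0] show "\<zero>\<^bsub>comps SymDias n\<^esub> \<in> I n" by simp
qed

lemma I_pcomp_right:
  assumes "1 \<le> i" "i \<le> m" "1 \<le> n" "u \<in> carrier (comps SymDias m)" "v \<in> I n"
  shows "pcomp SymDias m n i u v \<in> I (m + n - 1)"
proof -
  have "v \<in> carrier (comps SymDias n)"
    using assms I_subset by blast
  moreover have "1 \<le> m" using assms by simp
  moreover have "ns_ideal SymDias I"
    using ideal by (simp add: operad_ideal_def)
  ultimately show ?thesis
    using assms unfolding ns_ideal_def by (meson atLeastAtMost_iff)
qed

lemma I_finsum:
  assumes n: "1 \<le> n" and "finite S" "\<And>x. x \<in> S \<Longrightarrow> f x \<in> I n"
  shows "finsum (comps SymDias n) f S \<in> I n"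
proof -
  interpret M: module rat_ring "comps SymDias n" by (rule SymDias.comps_module[OF n])
  show ?thesis
    using assms(2,3)
  proof (induction S rule: finite_induct)
    case (insert x S)
    then have "f x \<in> carrier (comps SymDias n)" "f \<in> S \<rightarrow> carrier (comps SymDias n)"
      using I_subset[OF n] by auto
    with insert show ?case by (simp add: I_add[OF n])
  qed (simp add: I_zero[OF n])
qed

definition equiv_mod :: "nat \<Rightarrow> ((nat \<Rightarrow> nat) \<Rightarrow> (dias_op tree \<Rightarrow>\<^sub>0 rat) set) \<Rightarrow> ((nat \<Rightarrow> nat) \<Rightarrow> (dias_op tree \<Rightarrow>\<^sub>0 rat) set) \<Rightarrow> bool"
  where "equiv_mod n u v \<longleftrightarrow> u \<in> carrier (comps SymDias n) \<and> v \<in> carrier (comps SymDias n) \<and>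
    u \<ominus>\<^bsub>comps SymDias n\<^esub> v \<in> I n"

context
  fixes n :: nat
  assumes n: "1 \<le> n"
begin

interpretation M: module rat_ring "comps SymDias n" by (rule SymDias.comps_module[OF n])

lemma equiv_refl: "u \<in> carrier (comps SymDias n) \<Longrightarrow> equiv_mod n u u"
  by (simp add: equiv_mod_def a_minus_def M.M.r_neg I_zero n)

lemma equiv_sym: "equiv_mod n u v \<Longrightarrow> equiv_mod n v u"
proof -
  assume a: "equiv_mod n u v"
  then have "\<ominus>\<^bsub>comps SymDias n\<^esub> (u \<ominus>\<^bsub>comps SymDias n\<^esub> v) = v \<ominus>\<^bsub>comps SymDias n\<^esub> u"
    by (simp add: equiv_mod_def a_minus_def M.M.minus_add M.M.a_comm)
  with a I_minus[OF n, of "u \<ominus>\<^bsub>comps SymDias n\<^esub> v"] show ?thesis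
    by (simp add: equiv_mod_def)
qed

lemma equiv_trans: "\<lbrakk>equiv_mod n u v; equiv_mod n v w\<rbrakk> \<Longrightarrow> equiv_mod n u w"
proof -
  assume a: "equiv_mod n u v" "equiv_mod n v w"
  then have "(u \<ominus>\<^bsub>comps SymDias n\<^esub> v) \<oplus>\<^bsub>comps SymDias n\<^esub> (v \<ominus>\<^bsub>comps SymDias n\<^esub> w) = u \<ominus>\<^bsub>comps SymDias n\<^esub> w"
    by (intro symdias_eqI[OF n]) (simp_all add: equiv_mod_def component_add[OF n] component_diff[OF n])
  with a I_add[OF n] show ?thesis
    unfolding equiv_mod_def by metis
qed

lemma equiv_add:
  "\<lbrakk>equiv_mod n u v; equiv_mod n u' v'\<rbrakk> \<Longrightarrow>
   equiv_mod n (u \<oplus>\<^bsub>comps SymDias n\<^esub> u') (v \<oplus>\<^bsub>comps SymDias n\<^esub> v')"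
proof -
  assume a: "equiv_mod n u v" "equiv_mod n u' v'"
  then have "(u \<ominus>\<^bsub>comps SymDias n\<^esub> v) \<oplus>\<^bsub>comps SymDias n\<^esub> (u' \<ominus>\<^bsub>comps SymDias n\<^esub> v') =
      (u \<oplus>\<^bsub>comps SymDias n\<^esub> u') \<ominus>\<^bsub>comps SymDias n\<^esub> (v \<oplus>\<^bsub>comps SymDias n\<^esub> v')"
    by (intro symdias_eqI[OF n]) (simp_all add: equiv_mod_def component_add[OF n] component_diff[OF n])
  moreover have "(u \<ominus>\<^bsub>comps SymDias n\<^esub> v) \<oplus>\<^bsub>comps SymDias n\<^esub> (u' \<ominus>\<^bsub>comps SymDias n\<^esub> v') \<in> I n"
    using a by (intro I_add n) (simp_all add: equiv_mod_def)
  ultimately show ?thesis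
    using a by (simp add: equiv_mod_def)
qed

lemma equiv_smult:
  "equiv_mod n u v \<Longrightarrow> equiv_mod n (a \<odot>\<^bsub>comps SymDias n\<^esub> u) (a \<odot>\<^bsub>comps SymDias n\<^esub> v)"
proof -
  assume a: "equiv_mod n u v"
  have closed: "a \<odot>\<^bsub>comps SymDias n\<^esub> x \<in> carrier (comps SymDias n)" if "x \<in> carrier (comps SymDias n)" for x
    using that by (simp add: M.smult_closed)
  from a have "a \<odot>\<^bsub>comps SymDias n\<^esub> (u \<ominus>\<^bsub>comps SymDias n\<^esub> v) =
      (a \<odot>\<^bsub>comps SymDias n\<^esub> u) \<ominus>\<^bsub>comps SymDias n\<^esub> (a \<odot>\<^bsub>comps SymDias n\<^esub> v)"
    by (intro symdias_eqI[OF n])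
      (simp_all add: equiv_mod_def component_smult[OF n] component_diff[OF n] closed right_diff_distrib)
  then show ?thesis
    using a I_smult[OF n, of "u \<ominus>\<^bsub>comps SymDias n\<^esub> v" a] by (simp add: equiv_mod_def closed)
qed

lemma equiv_sact:
  assumes a: "equiv_mod n u v" and \<sigma>: "\<sigma> permutes {1..n}"
  shows "equiv_mod n (sact SymDias n \<sigma> u) (sact SymDias n \<sigma> v)"
proof -
  have u: "u \<in> carrier (comps SymDias n)" "v \<in> carrier (comps SymDias n)"
    using a by (simp_all add: equiv_mod_def)
  note closed = sact_symmetrization_closed[OF \<sigma>, of _ Dias]
  have perm: "inv' \<sigma> \<circ> r \<in> perms n" if "r \<in> perms n" for r
    using that \<sigma> by (simp add: permutes_compose permutes_inv)
  have "sact SymDias n \<sigma> (u \<ominus>\<^bsub>comps SymDias n\<^esub> v) =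
      sact SymDias n \<sigma> u \<ominus>\<^bsub>comps SymDias n\<^esub> sact SymDias n \<sigma> v"
  proof (rule symdias_eqI[OF n])
    fix r F assume r: "r \<in> perms n"
    show "dias_pairing (sact SymDias n \<sigma> (u \<ominus>\<^bsub>comps SymDias n\<^esub> v) r) F =
        dias_pairing ((sact SymDias n \<sigma> u \<ominus>\<^bsub>comps SymDias n\<^esub> sact SymDias n \<sigma> v) r) F"
      using r perm[OF r] u closed
      by (simp add: component_diff[OF n]) (simp add: symmetrization_simps(5) component_diff[OF n])
  qed (simp_all add: u closed)
  moreover have "sact SymDias n \<sigma> (u \<ominus>\<^bsub>comps SymDias n\<^esub> v) \<in> I n"
    using a ideal \<sigma> n by (auto simp: operad_ideal_def equiv_mod_def)
  ultimately show ?thesis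
    using u closed by (simp add: equiv_mod_def)
qed

text \<open>Modulo the ideal, the order of the variables given by \<open>w\<close> may be replaced by the standard order
  without changing the variable in the head.\<close>

definition straightens :: "(nat \<Rightarrow> nat) \<Rightarrow> bool" where
  "straightens w \<longleftrightarrow> (\<forall>X\<in>carrier (comps Dias n). \<exists>Y\<in>carrier (comps Dias n).
     (\<forall>F. dias_pairing Y F = dias_pairing X (F \<circ> w)) \<and>
     equiv_mod n (pure_tensor Dias n X w) (pure_tensor Dias n Y id))"

lemma straightens_id: "straightens id"
  unfolding straightens_def by (auto intro!: bexI equiv_refl pure_tensor_closed n)

lemma straightens_compose:
  assumes v: "straightens v" "v permutes {1..n}" and w: "straightens w" "w permutes {1..n}"
  shows "straightens (v \<circ> w)"
  unfolding straightens_def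
proof
  fix X assume X: "X \<in> carrier (comps Dias n)"
  obtain Y where Y: "Y \<in> carrier (comps Dias n)" "\<And>F. dias_pairing Y F = dias_pairing X (F \<circ> w)"
    "equiv_mod n (pure_tensor Dias n X w) (pure_tensor Dias n Y id)"
    using w(1) X unfolding straightens_def by blast
  obtain Z where Z: "Z \<in> carrier (comps Dias n)" "\<And>F. dias_pairing Z F = dias_pairing Y (F \<circ> v)"
    "equiv_mod n (pure_tensor Dias n Y v) (pure_tensor Dias n Z id)"
    using v(1) Y(1) unfolding straightens_def by blast
  have "equiv_mod n (pure_tensor Dias n X (v \<circ> w)) (pure_tensor Dias n Y v)"
    using equiv_sact[OF Y(3) v(2)] X Y(1) v(2) w(2) by (simp add: sact_pure_tensor n permutes_id)
  from equiv_trans[OF this Z(3)] show "\<exists>Y\<in>carrier (comps Dias n).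
     (\<forall>F. dias_pairing Y F = dias_pairing X (F \<circ> (v \<circ> w))) \<and>
     equiv_mod n (pure_tensor Dias n X (v \<circ> w)) (pure_tensor Dias n Y id)"
    using Z(1,2) Y(2) by (auto simp: o_assoc)
qed

text \<open>Composing with the relation at the input \<open>i\<close> of an element of arity \<open>n - 1\<close> and head \<open>p\<close> gives the case
  of a head \<open>\<noteq> i\<close>: choose \<open>p\<close> to be the position left when the inputs
  \<open>i\<close> and \<open>i + 1\<close> are merged. The case of the head \<open>i\<close> follows from that of \<open>i + 1\<close> by applying the transposition
  to both sides.\<close>

lemma adjacent_equiv:
  assumes i: "1 \<le> i" "i < n" and w: "w = transpose i (i + 1)"
    and t: "size1 t = n" and t': "size1 t' = n" "head t' = w (head t)"
  shows "equiv_mod n (pure_tensor Dias n (dias_tree t) w) (pure_tensor Dias n (dias_tree t') id)"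
proof -
  have w_perm: "w permutes {1..n}"
    unfolding w using i by (intro permutes_swap_id) auto
  have eq: "dias_tree t = dias_tree u" if "size1 t = n" "size1 u = n" "head t = head u" for t u
    using that by (intro dias_eqI[OF n]) (simp_all add: dias_tree_closed)
  have *: "equiv_mod n (pure_tensor Dias n (dias_tree t) w) (pure_tensor Dias n (dias_tree t') id)"
    if t: "size1 t = n" and t': "size1 t' = n" "head t' = w (head t)" and h: "head t \<noteq> i" for t t'
  proof -
    define m where "m = n - 1"
    have m: "n = m + 1" "1 \<le> m" "i \<le> m" "m + 2 - 1 = n" using i by (simp_all add: m_def)
    define p where "p = (if head t < i then head t else head t - 1)"
    have p: "p \<in> {1..m}"
      using h head_bounds[of t] t i m(1) by (auto simp: p_def)
    define X where "X = dias_tree (normal_tree m p)"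
    have X: "X \<in> carrier (comps Dias m)"
      unfolding X_def by (intro dias_tree_closed size1_normal_tree p)
    have LX: "dias_pairing X F = F p" for F
      unfolding X_def dias_pairing_tree head_normal_tree[OF p] ..
    have closed: "pcomp Dias m 2 i X (dias_gen a) \<in> carrier (comps Dias n)" for a
      by (rule Dias.pcomp_closed[OF i(1) m(3) _ X dias_gen_closed, unfolded m(4)]) simp
    have L: "dias_pairing (pcomp Dias m 2 i X (dias_gen a)) F = dias_pairing (dias_gen a) (\<lambda>q. F (head_index 2 i p q))" for a F
      using Dias.L_pcomp[OF i(1) m(3) _ X dias_gen_closed] by (simp add: LX)
    have "pcomp Dias m 2 i X (dias_gen \<turnstile>) = dias_tree t"
      using h by (intro dias_eqI[OF n closed dias_tree_closed[OF t]])
        (auto simp: L p_def head_index_def)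
    moreover have "pcomp Dias m 2 i X (dias_gen \<stileturn>) = dias_tree t'"
      using h by (intro dias_eqI[OF n closed dias_tree_closed[OF t'(1)]])
        (auto simp: L p_def head_index_def t'(2) w transpose_def)
    ultimately have "pcomp SymDias m 2 i (pure_tensor Dias m X id) perm_relation =
        pure_tensor Dias n (dias_tree t') id \<ominus>\<^bsub>comps SymDias n\<^esub> pure_tensor Dias n (dias_tree t) w"
      using pcomp_perm_relation[OF i(1) m(3) X] by (simp add: w m(1)[symmetric])
    moreover have "pcomp SymDias m 2 i (pure_tensor Dias m X id) perm_relation \<in> I n"
    proof -
      have "perm_relation \<in> I 2"
        using relations[of 2] by (simp add: perm_relations_eq)
      with i(1) m(3) pure_tensor_closed[OF m(2) X] show ?thesis
        by (intro I_pcomp_right[of i m 2, unfolded m(4)]) simp_all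
    qed
    ultimately have "equiv_mod n (pure_tensor Dias n (dias_tree t') id) (pure_tensor Dias n (dias_tree t) w)"
      using dias_tree_closed[OF t] dias_tree_closed[OF t'(1)]
      by (simp add: equiv_mod_def pure_tensor_closed n)
    then show ?thesis by (rule equiv_sym)
  qed
  show ?thesis
  proof (cases "head t = i")
    case False
    then show ?thesis using * t t' by blast
  next
    case True
    have "head t = w (head t')"
      using t'(2) by (simp add: w)
    moreover have "head t' \<noteq> i"
      using True t'(2) by (simp add: w)
    ultimately have "equiv_mod n (pure_tensor Dias n (dias_tree t') w) (pure_tensor Dias n (dias_tree t) id)"
      using * t t' by blast
    from equiv_sact[OF this w_perm] have
      "equiv_mod n (pure_tensor Dias n (dias_tree t') (w \<circ> w)) (pure_tensor Dias n (dias_tree t) w)"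
      using t t'(1) w_perm by (simp add: sact_pure_tensor n dias_tree_closed permutes_id)
    moreover have "w \<circ> w = id" by (simp add: w)
    ultimately show ?thesis by (simp add: equiv_sym)
  qed
qed

lemma straightens_adjacent:
  assumes i: "1 \<le> i" "i < n"
  shows "straightens (transpose i (i + 1))"
  unfolding straightens_def
proof
  let ?w = "transpose i (i + 1)"
  interpret D: module rat_ring "comps Dias n" by (rule Dias.comps_module[OF n])
  fix X assume "X \<in> carrier (comps Dias n)"
  with n show "\<exists>Y\<in>carrier (comps Dias n). (\<forall>F. dias_pairing Y F = dias_pairing X (F \<circ> ?w)) \<and>
     equiv_mod n (pure_tensor Dias n X ?w) (pure_tensor Dias n Y id)"
  proof (induction rule: dias_induct)
    case (tree t)
    have h: "?w (head t) \<in> {1..n}"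
      using head_bounds[of t] tree i by (auto simp: transpose_def)
    show ?case
    proof (intro bexI conjI allI)
      show "dias_tree (normal_tree n (?w (head t))) \<in> carrier (comps Dias n)"
        by (intro dias_tree_closed size1_normal_tree h)
      show "dias_pairing (dias_tree (normal_tree n (?w (head t)))) F = dias_pairing (dias_tree t) (F \<circ> ?w)" for F
        by (simp only: dias_pairing_tree head_normal_tree[OF h] o_apply)
      show "equiv_mod n (pure_tensor Dias n (dias_tree t) ?w)
          (pure_tensor Dias n (dias_tree (normal_tree n (?w (head t)))) id)"
        using adjacent_equiv[OF i refl tree size1_normal_tree[OF h] head_normal_tree[OF h]] .
    qed
  next
    case (add X Y)
    then obtain X' Y' where X': "X' \<in> carrier (comps Dias n)"
        "\<And>F. dias_pairing X' F = dias_pairing X (F \<circ> ?w)"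
        "equiv_mod n (pure_tensor Dias n X ?w) (pure_tensor Dias n X' id)"
      and Y': "Y' \<in> carrier (comps Dias n)"
        "\<And>F. dias_pairing Y' F = dias_pairing Y (F \<circ> ?w)"
        "equiv_mod n (pure_tensor Dias n Y ?w) (pure_tensor Dias n Y' id)"
      by blast
    show ?case
    proof (intro bexI conjI allI)
      show "X' \<oplus>\<^bsub>comps Dias n\<^esub> Y' \<in> carrier (comps Dias n)"
        using X'(1) Y'(1) by (rule D.M.a_closed)
      show "dias_pairing (X' \<oplus>\<^bsub>comps Dias n\<^esub> Y') F = dias_pairing (X \<oplus>\<^bsub>comps Dias n\<^esub> Y) (F \<circ> ?w)" for F
        using add(1,2) X' Y' by (simp only: Dias.L_add[OF n])
      show "equiv_mod n (pure_tensor Dias n (X \<oplus>\<^bsub>comps Dias n\<^esub> Y) ?w)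
          (pure_tensor Dias n (X' \<oplus>\<^bsub>comps Dias n\<^esub> Y') id)"
        unfolding pure_tensor_add[OF n add(1,2)] pure_tensor_add[OF n X'(1) Y'(1)]
        using X'(3) Y'(3) by (rule equiv_add)
    qed
  next
    case (smult a X)
    then obtain X' where X': "X' \<in> carrier (comps Dias n)"
        "\<And>F. dias_pairing X' F = dias_pairing X (F \<circ> ?w)"
        "equiv_mod n (pure_tensor Dias n X ?w) (pure_tensor Dias n X' id)"
      by blast
    show ?case
    proof (intro bexI conjI allI)
      show "a \<odot>\<^bsub>comps Dias n\<^esub> X' \<in> carrier (comps Dias n)"
        using X'(1) by (simp add: D.smult_closed)
      show "dias_pairing (a \<odot>\<^bsub>comps Dias n\<^esub> X') F = dias_pairing (a \<odot>\<^bsub>comps Dias n\<^esub> X) (F \<circ> ?w)" for F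
        using smult(1) X' by (simp only: Dias.L_smult[OF n])
      show "equiv_mod n (pure_tensor Dias n (a \<odot>\<^bsub>comps Dias n\<^esub> X) ?w)
          (pure_tensor Dias n (a \<odot>\<^bsub>comps Dias n\<^esub> X') id)"
        unfolding pure_tensor_smult[OF n smult(1)] pure_tensor_smult[OF n X'(1)]
        using X'(3) by (rule equiv_smult)
    qed
  qed
qed

text \<open>Adjacent transpositions generate the symmetric group.\<close>

lemma straightens_perm: "w permutes {1..n} \<Longrightarrow> straightens w"
proof -
  have adj: "straightens (apply_adj_transps xs) \<and> apply_adj_transps xs permutes {1..n}"
    if "set xs \<subseteq> {1..<n}" for xs
    using that
  proof (induction xs)
    case (Cons x xs)
    then have "straightens (transpose x (x + 1))" "transpose x (x + 1) permutes {1..n}"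
      by (auto intro!: straightens_adjacent permutes_swap_id)
    moreover have "straightens (apply_adj_transps xs)" "apply_adj_transps xs permutes {1..n}"
      using Cons by simp_all
    ultimately show ?case
      unfolding apply_adj_transps_Cons by (blast intro: straightens_compose permutes_compose)
  qed (simp add: straightens_id permutes_id)
  have swap: "straightens (transpose a b)" if ab: "a \<in> {1..n}" "b \<in> {1..n}" "a < b" for a b
    using adj[of "adj_transp_seq a b"] ab by (auto simp: adj_transp_seq_correct set_adj_transp_seq)
  show "straightens w" if "w permutes {1..n}"
    using that finite_atLeastAtMost
  proof (induction rule: permutes_induct)
    case (swap a b p)
    then have "straightens (transpose a b)"
      using \<open>\<And>b a. \<lbrakk>a \<in> {1..n}; b \<in> {1..n}; a < b\<rbrakk> \<Longrightarrow> straightens (transpose a b)\<close>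
      by (metis linorder_neqE_nat transpose_commute)
    with swap show ?case
      by (intro straightens_compose) (auto intro: permutes_swap_id)
  qed (rule straightens_id)
qed

text \<open>Straightening all terms of \<open>u = \<Sum>\<^sub>s u\<^sub>s \<otimes> s\<close> changes \<open>u\<close> by an element of the ideal and yields \<open>Z \<otimes> id\<close>, where the
  pairing of \<open>Z\<close> is that of \<open>u\<close>. This vanishes, so \<open>Z = 0\<close>.\<close>

lemma annihilated_subset: "annihilated (comps SymDias n) (symdias_pairing n) \<subseteq> I n"
proof
  fix u assume "u \<in> annihilated (comps SymDias n) (symdias_pairing n)"
  then have u: "u \<in> carrier (comps SymDias n)" and zero: "symdias_pairing n u F = 0" for F
    by (simp_all add: annihilated_def)
  have u_closed: "u s \<in> carrier (comps Dias n)" if "s \<in> perms n" for s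
    using u that by (auto simp: symmetrization_simps)
  have "\<forall>s\<in>perms n. \<exists>Y\<in>carrier (comps Dias n). (\<forall>F. dias_pairing Y F = dias_pairing (u s) (F \<circ> s)) \<and>
      equiv_mod n (pure_tensor Dias n (u s) s) (pure_tensor Dias n Y id)"
    using straightens_perm u_closed unfolding straightens_def by blast
  then obtain Y where Y: "\<And>s. s \<in> perms n \<Longrightarrow> Y s \<in> carrier (comps Dias n)"
    "\<And>s F. s \<in> perms n \<Longrightarrow> dias_pairing (Y s) F = dias_pairing (u s) (F \<circ> s)"
    "\<And>s. s \<in> perms n \<Longrightarrow> equiv_mod n (pure_tensor Dias n (u s) s) (pure_tensor Dias n (Y s) id)"
    by metis
  let ?d = "\<lambda>s. pure_tensor Dias n (u s) s \<ominus>\<^bsub>comps SymDias n\<^esub> pure_tensor Dias n (Y s) id"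
  have d: "?d s \<in> I n" if "s \<in> perms n" for s
    using Y(3)[OF that] by (simp add: equiv_mod_def)
  have eq: "u = finsum (comps SymDias n) ?d (perms n)"
  proof (rule symdias_eqI[OF n u])
    show "finsum (comps SymDias n) ?d (perms n) \<in> carrier (comps SymDias n)"
      using d I_subset[OF n] by (intro M.M.finsum_closed) auto
    fix r F assume r: "r \<in> perms n"
    have "dias_pairing (finsum (comps SymDias n) ?d (perms n) r) F = (\<Sum>s\<in>perms n. dias_pairing (?d s r) F)"
      using functional_family.L_finsum[OF component_family[OF n r] finite_perms, of n ?d] d I_subset[OF n]
      by blast
    also have "\<dots> = (\<Sum>s\<in>perms n. (if r = s then dias_pairing (u s) F else 0) -
        (if r = id then dias_pairing (u s) (F \<circ> s) else 0))"
      by (rule sum.cong[OF refl])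
        (simp add: component_diff[OF n r] pure_tensor_closed n u_closed Y pure_tensor_component[OF n r])
    also have "\<dots> = dias_pairing (u r) F - (if r = id then symdias_pairing n u F else 0)"
      using r by (simp add: sum_subtractf finite_perms sym_pairing_def)
    finally show "dias_pairing (u r) F = dias_pairing (finsum (comps SymDias n) ?d (perms n) r) F"
      by (simp add: zero)
  qed
  show "u \<in> I n"
    by (subst eq) (rule I_finsum[OF n finite_perms d])
qed

end

end

text \<open>As for Dias, the annihilator is the smallest ideal containing the relation. So Perm has in arity \<open>n\<close> one basis element for each variable that can stand in the head.\<close>

lemma perm_ideal_eq:
  assumes n: "1 \<le> n"
  shows "perm_ideal n = annihilated (comps SymDias n) (symdias_pairing n)"
proof
  let ?I = "\<lambda>n. annihilated (comps SymDias n) (symdias_pairing n)"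
  have "perm_relation \<in> ?I 2"
  proof -
    interpret functional_family "comps SymDias 2" "symdias_pairing 2"
      by (rule SymDias.functional_family) simp
    have "symdias_pairing 2 perm_relation F = 0" for F
      using transpose_12(1)
      by (simp add: perm_relation_def L_diff pure_tensor_closed dias_gen_closed
          symdias_pairing_pure_tensor permutes_id)
    then show ?thesis
      by (simp add: annihilated_def perm_relation_closed)
  qed
  then have "perm_relations k \<subseteq> ?I k" for k
    by (simp add: perm_relations_eq)
  then show "perm_ideal n \<subseteq> ?I n"
    using Dias.operad_ideal_symmetrization
    unfolding perm_ideal_def operad_ideal_gen_def by blast
  show "?I n \<subseteq> perm_ideal n"
    unfolding perm_ideal_def operad_ideal_gen_def
    using perm_ideal_above.annihilated_subset[OF perm_ideal_above.intro n] by blast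
qed

section \<open>The action of the symmetric group on \<open>n + 1\<close> letters\<close>

lemma long_cycle_funpow:
  assumes "j \<in> {1..n + 1}" "k \<le> n"
  shows "(long_cycle n ^^ k) j = (if k < j then j - k else j + (n + 1) - k)"
  using assms(2)
proof (induction k)
  case (Suc k)
  then have "(long_cycle n ^^ k) j = (if k < j then j - k else j + (n + 1) - k)" by simp
  then have "(long_cycle n ^^ Suc k) j = long_cycle n (if k < j then j - k else j + (n + 1) - k)"
    by simp
  also have "\<dots> = (if Suc k < j then j - Suc k else j + (n + 1) - Suc k)"
    using Suc.prems assms(1) by (auto simp: long_cycle_def)
  finally show ?case .
qed (use assms in simp)

lemma long_cycle_permutes: "long_cycle n permutes {1..n + 1}"
proof (rule bij_imp_permutes)
  show "bij_betw (long_cycle n) {1..n + 1} {1..n + 1}"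
    by (rule bij_betw_byWitness[where f' = "\<lambda>i. if i = n + 1 then 1 else i + 1"])
      (auto simp: long_cycle_def)
  show "long_cycle n i = i" if "i \<notin> {1..n + 1}" for i
    using that by (auto simp: long_cycle_def)
qed

text \<open>The powers of the long cycle represent the cosets of the stabilizer of \<open>n + 1\<close>: exactly one
  of them maps the preimage of \<open>n + 1\<close> under \<open>w\<close> to \<open>n + 1\<close>.\<close>

lemma long_cycle_factorization:
  assumes w: "w permutes {1..n + 1}"
  obtains t\<^sub>0 k\<^sub>0 where "t\<^sub>0 \<in> perms n" "k\<^sub>0 \<in> {0..n}"
    "\<And>t k. \<lbrakk>t \<in> perms n; k \<in> {0..n}\<rbrakk> \<Longrightarrow> w = t \<circ> (long_cycle n ^^ k) \<longleftrightarrow> t = t\<^sub>0 \<and> k = k\<^sub>0"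
proof -
  let ?c = "long_cycle n"
  define j where "j = inv' w (n + 1)"
  have j: "j \<in> {1..n + 1}" "w j = n + 1"
    using permutes_in_image[OF permutes_inv[OF w], of "n + 1"] permutes_inverses(1)[OF w]
    by (simp_all add: j_def)
  \<comment> \<open>This is \<open>j\<close> modulo \<open>n + 1\<close>, since the cycle lowers an index by one.\<close>
  define k\<^sub>0 where "k\<^sub>0 = (if j = n + 1 then 0 else j)"
  have k\<^sub>0: "k\<^sub>0 \<in> {0..n}" using j by (auto simp: k\<^sub>0_def)
  have k_unique: "(?c ^^ k) j = n + 1 \<longleftrightarrow> k = k\<^sub>0" if "k \<in> {0..n}" for k
    using that j(1) by (subst long_cycle_funpow) (auto simp: k\<^sub>0_def)
  have c: "(?c ^^ k) permutes {1..n + 1}" for k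
    by (induction k) (simp_all only: funpow.simps permutes_id permutes_compose long_cycle_permutes)
  define t\<^sub>0 where "t\<^sub>0 = w \<circ> inv' (?c ^^ k\<^sub>0)"
  have w_eq: "w = t\<^sub>0 \<circ> (?c ^^ k\<^sub>0)"
    using permutes_inverses(2)[OF c] by (simp add: t\<^sub>0_def fun_eq_iff)
  have t\<^sub>0: "t\<^sub>0 permutes {1..n}"
  proof (rule permutes_superset)
    show "t\<^sub>0 permutes {1..n + 1}"
      unfolding t\<^sub>0_def by (intro permutes_compose permutes_inv w c)
    have "t\<^sub>0 (n + 1) = n + 1"
      using j(2) k_unique[OF k\<^sub>0] w_eq by (metis comp_apply)
    then show "t\<^sub>0 x = x" if "x \<in> {1..n + 1} - {1..n}" for x
      using that by (metis DiffD1 DiffD2 add.commute atLeastAtMost_iff le_Suc_eq plus_1_eq_Suc)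
  qed
  show thesis
  proof (rule that)
    show "t\<^sub>0 \<in> perms n" "k\<^sub>0 \<in> {0..n}" using t\<^sub>0 k\<^sub>0 by simp_all
    fix t k assume t: "t \<in> perms n" and k: "k \<in> {0..n}"
    show "w = t \<circ> (?c ^^ k) \<longleftrightarrow> t = t\<^sub>0 \<and> k = k\<^sub>0"
    proof
      assume w_tk: "w = t \<circ> (?c ^^ k)"
      have "t (n + 1) = n + 1"
        using t permutes_not_in[of t "{1..n}" "n + 1"] by simp
      moreover have "t ((?c ^^ k) j) = n + 1"
        using j(2) w_tk by simp
      moreover have "inj t" using t by (auto intro: permutes_inj)
      ultimately have "(?c ^^ k) j = n + 1"
        by (metis injD)
      then have "k = k\<^sub>0" using k_unique[OF k] by simp
      moreover have "t = w \<circ> inv' (?c ^^ k)"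
        using permutes_inverses(1)[OF c] by (simp add: w_tk fun_eq_iff)
      ultimately show "t = t\<^sub>0 \<and> k = k\<^sub>0" by (simp add: t\<^sub>0_def)
    qed (use w_eq in simp)
  qed
qed

lemma symmetrization_action_closed:
  assumes \<tau>: "dias_anticyclic \<tau>" and n: "1 \<le> n" and u: "u \<in> carrier (comps SymDias n)"
  shows "symmetrization_action Dias \<tau> n g u \<in> carrier (comps SymDias n)"
proof -
  interpret D: module rat_ring "comps Dias n" by (rule Dias.comps_module[OF n])
  have "(\<tau> n ^^ k) (u s) \<in> carrier (comps Dias n)" if "s \<in> perms n" for s k
    using dias_anticyclic_pairing_funpow[OF \<tau> n, of "u s"] u that
    by (auto simp: symmetrization_simps)
  then show ?thesis
    by (auto simp: symmetrization_action_def symmetrization_simps intro!: D.M.finsum_closed)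
qed

text \<open>A monomial with the variable \<open>x\<^sub>p\<close> in its head is paired like the vector \<open>\<epsilon>\<^sub>p - \<epsilon>\<^bsub>n+1\<^esub>\<close>.\<close>

definition reduced_pairing ::
  "nat \<Rightarrow> ((nat \<Rightarrow> nat) \<Rightarrow> (dias_op tree \<Rightarrow>\<^sub>0 rat) set) \<Rightarrow> (nat \<Rightarrow> rat) \<Rightarrow> rat" where
  "reduced_pairing n u F = symdias_pairing n u (\<lambda>p. F p - F (n + 1))"

text \<open>Equivariance. A term \<open>E \<otimes> s\<close> with \<open>g s = t c\<^sup>k\<close> is sent to \<open>\<tau>\<^sup>k E \<otimes> t\<close>. By the formula for
  \<open>\<tau>\<close>, pairing this with \<open>F\<close> amounts to pairing \<open>E\<close> with \<open>F \<circ> t c\<^sup>k = F \<circ> g s\<close>, whatever \<open>t\<close> and \<open>k\<close> are.\<close>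

lemma reduced_pairing_action:
  assumes \<tau>: "dias_anticyclic \<tau>" and n: "1 \<le> n" and u: "u \<in> carrier (comps SymDias n)"
    and g: "g permutes {1..n + 1}"
  shows "reduced_pairing n (symmetrization_action Dias \<tau> n g u) F = reduced_pairing n u (F \<circ> g)"
proof -
  interpret D: functional_family "comps Dias n" dias_pairing by (rule Dias.functional_family[OF n])
  let ?c = "long_cycle n"
  let ?h = "\<lambda>s. dias_pairing (u s) (\<lambda>p. F (g (s p)) - F (g (n + 1)))"
  have u_closed: "u s \<in> carrier (comps Dias n)" if "s \<in> perms n" for s
    using u that by (auto simp: symmetrization_simps)
  note \<tau>k = dias_anticyclic_pairing_funpow[OF \<tau> n u_closed]
  have fixes_last: "s (n + 1) = n + 1" if "s \<in> perms n" for s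
    using that permutes_not_in[of s "{1..n}" "n + 1"] by simp
  have fin: "finite (perms n \<times> {0..n})" by (intro finite_cartesian_product finite_perms) simp
  have "dias_pairing (symmetrization_action Dias \<tau> n g u t) ((\<lambda>p. F p - F (n + 1)) \<circ> t) =
      (\<Sum>(s, k)\<in>perms n \<times> {0..n}. if g \<circ> s = t \<circ> (?c ^^ k) then ?h s else 0)" if t: "t \<in> perms n" for t
  proof -
    let ?S = "{x \<in> perms n \<times> {0..n}. (\<lambda>(s, k). g \<circ> s = t \<circ> (?c ^^ k)) x}"
    have "{(s, k) \<in> perms n \<times> {0..n}. g \<circ> s = t \<circ> (?c ^^ k)} = ?S" by auto
    then have "symmetrization_action Dias \<tau> n g u t = finsum (comps Dias n) (\<lambda>(s, k). (\<tau> n ^^ k) (u s)) ?S"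
      using t by (simp add: symmetrization_action_def)
    then have "dias_pairing (symmetrization_action Dias \<tau> n g u t) ((\<lambda>p. F p - F (n + 1)) \<circ> t) =
        (\<Sum>x\<in>?S. dias_pairing (case x of (s, k) \<Rightarrow> (\<tau> n ^^ k) (u s)) ((\<lambda>p. F p - F (n + 1)) \<circ> t))"
      using \<tau>k by (simp only:) (rule D.L_finsum, auto intro: finite_subset[OF _ fin])
    also have "\<dots> = (\<Sum>x\<in>?S. (\<lambda>(s, k). ?h s) x)"
    proof (rule sum.cong[OF refl])
      fix x assume "x \<in> ?S"
      then obtain s k where x: "x = (s, k)" "s \<in> perms n" "g \<circ> s = t \<circ> (?c ^^ k)" by auto
      have "(\<lambda>p. F p - F (n + 1)) \<circ> t = (\<lambda>p. (F \<circ> t) p - (F \<circ> t) (n + 1))"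
        using fixes_last[OF t] by (simp add: fun_eq_iff)
      moreover have "(F \<circ> t) ((?c ^^ k) p) = F (g (s p))" for p
        using x(3) by (metis comp_apply)
      ultimately show "dias_pairing (case x of (s, k) \<Rightarrow> (\<tau> n ^^ k) (u s)) ((\<lambda>p. F p - F (n + 1)) \<circ> t) =
          (\<lambda>(s, k). ?h s) x"
        using \<tau>k[OF x(2), of k "F \<circ> t"] fixes_last[OF x(2)] by (simp only: x(1) prod.case)
    qed
    also have "\<dots> = (\<Sum>(s, k)\<in>perms n \<times> {0..n}. if g \<circ> s = t \<circ> (?c ^^ k) then ?h s else 0)"
      by (subst sum.inter_filter[OF fin]) (auto intro!: sum.cong)
    finally show ?thesis .
  qed
  then have "reduced_pairing n (symmetrization_action Dias \<tau> n g u) F =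
      (\<Sum>t\<in>perms n. \<Sum>(s, k)\<in>perms n \<times> {0..n}. if g \<circ> s = t \<circ> (?c ^^ k) then ?h s else 0)"
    by (simp add: reduced_pairing_def sym_pairing_def)
  also have "\<dots> = (\<Sum>t\<in>perms n. \<Sum>s\<in>perms n. \<Sum>k\<in>{0..n}. if g \<circ> s = t \<circ> (?c ^^ k) then ?h s else 0)"
    by (simp add: sum.cartesian_product)
  also have "\<dots> = (\<Sum>s\<in>perms n. \<Sum>t\<in>perms n. \<Sum>k\<in>{0..n}. if g \<circ> s = t \<circ> (?c ^^ k) then ?h s else 0)"
    by (rule sum.swap)
  \<comment> \<open>Each \<open>s\<close> contributes once, because \<open>g s\<close> factors as \<open>t c\<^sup>k\<close> in a unique way.\<close>
  also have "\<dots> = (\<Sum>s\<in>perms n. ?h s)"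
  proof (rule sum.cong[OF refl])
    fix s assume s: "s \<in> perms n"
    then have "s permutes {1..n + 1}"
      by (auto elim: permutes_subset)
    then obtain t\<^sub>0 k\<^sub>0 where tk: "t\<^sub>0 \<in> perms n" "k\<^sub>0 \<in> {0..n}"
      "\<And>t k. \<lbrakk>t \<in> perms n; k \<in> {0..n}\<rbrakk> \<Longrightarrow> g \<circ> s = t \<circ> (?c ^^ k) \<longleftrightarrow> t = t\<^sub>0 \<and> k = k\<^sub>0"
      using long_cycle_factorization[OF permutes_compose[OF _ g]] by metis
    have "(\<Sum>t\<in>perms n. \<Sum>k\<in>{0..n}. if g \<circ> s = t \<circ> (?c ^^ k) then ?h s else 0) =
        (\<Sum>t\<in>perms n. if t = t\<^sub>0 then (\<Sum>k\<in>{0..n}. if k = k\<^sub>0 then ?h s else 0) else 0)"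
      using tk(3) by (intro sum.cong refl) (auto intro!: sum.cong sum.neutral)
    also have "\<dots> = ?h s"
      using tk(1,2) by (simp add: finite_perms)
    finally show "(\<Sum>t\<in>perms n. \<Sum>k\<in>{0..n}. if g \<circ> s = t \<circ> (?c ^^ k) then ?h s else 0) = ?h s" .
  qed
  also have "\<dots> = reduced_pairing n u (F \<circ> g)"
    by (simp add: reduced_pairing_def sym_pairing_def o_def)
  finally show ?thesis .
qed

section \<open>The reflection representation\<close>

lemma linext_permutation_action: "linext G (permutation_action g v) = linext (G \<circ> g) v"
  by (simp add: permutation_action_def linext_def[of _ v])

lemma linext_one_to_n:
  fixes n :: nat
  assumes "Poly_Mapping.keys v \<subseteq> {1..n + 1}"
  shows "linext F v = (\<Sum>m = 1..n. Poly_Mapping.lookup v m * F m) + Poly_Mapping.lookup v (n + 1) * F (n + 1)"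
proof -
  have "{1..n + 1} = insert (n + 1) {1..n}" by auto
  then show ?thesis
    using linext_superset[OF _ assms, of F] by (simp add: add.commute)
qed

definition reflection_vector :: "nat \<Rightarrow> (nat \<Rightarrow> rat) \<Rightarrow> nat \<Rightarrow>\<^sub>0 rat" where
  "reflection_vector n a = (\<Sum>m = 1..n. Poly_Mapping.map ((*) (a m)) (basis_vec m - basis_vec (n + 1)))"

lemma linext_reflection_vector:
  "linext F (reflection_vector n a) = (\<Sum>m = 1..n. a m * (F m - F (n + 1)))"
  by (simp add: reflection_vector_def)

lemma reflection_module_simps [simp]:
  "v \<oplus>\<^bsub>reflection_module n\<^esub> w = v + w"
  "a \<odot>\<^bsub>reflection_module n\<^esub> v = Poly_Mapping.map ((*) a) v"
  by (simp_all add: reflection_module_def free_module_def)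

lemma reflection_module_carrier: "carrier (reflection_module n) = range (reflection_vector n)"
  by (auto simp: reflection_module_def reflection_vector_def)

text \<open>The span of the \<open>\<epsilon>\<^sub>m - \<epsilon>\<^bsub>n+1\<^esub>\<close> is the hyperplane of coefficient sum zero, which is visibly stable
  under permutations.\<close>

lemma reflection_module_carrier_iff:
  "v \<in> carrier (reflection_module n) \<longleftrightarrow>
    Poly_Mapping.keys v \<subseteq> {1..n + 1} \<and> linext (\<lambda>_. 1) v = 0"
proof
  assume "v \<in> carrier (reflection_module n)"
  then obtain a where v: "v = reflection_vector n a"
    by (auto simp: reflection_module_carrier)
  have "linext (\<lambda>s. of_bool (s = t)) v = 0" if "t \<notin> {1..n + 1}" for t
    unfolding v linext_reflection_vector using that by (intro sum.neutral) auto
  then show "Poly_Mapping.keys v \<subseteq> {1..n + 1} \<and> linext (\<lambda>_. 1) v = 0"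
    using keys_linext[of "{1..n + 1}" v] by (simp add: v linext_reflection_vector)
next
  assume v: "Poly_Mapping.keys v \<subseteq> {1..n + 1} \<and> linext (\<lambda>_. 1) v = 0"
  note expand = linext_one_to_n[OF conjunct1[OF v]]
  from v have last: "Poly_Mapping.lookup v (n + 1) = - (\<Sum>m = 1..n. Poly_Mapping.lookup v m)"
    using expand[of "\<lambda>_. 1"] by simp
  have "v = reflection_vector n (Poly_Mapping.lookup v)"
    by (rule linext_eqI)
      (use last in \<open>simp add: expand linext_reflection_vector right_diff_distrib sum_subtractf
        sum_distrib_right\<close>)
  then show "v \<in> carrier (reflection_module n)"
    by (auto simp: reflection_module_carrier)
qed

lemma linear_rep_reflection_module:
  "linear_rep (sym_group (n + 1)) (reflection_module n) permutation_action"
  unfolding linear_rep_def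
proof (intro conjI ballI)
  fix g assume "g \<in> carrier (sym_group (n + 1))"
  then have g: "g permutes {1..n + 1}" by (simp add: sym_group_def)
  have "permutation_action g v \<in> carrier (reflection_module n)"
    if "v \<in> carrier (reflection_module n)" for v
  proof -
    have v: "Poly_Mapping.keys v \<subseteq> {1..n + 1}" "linext (\<lambda>_. 1) v = 0"
      using that by (simp_all add: reflection_module_carrier_iff)
    have "linext (\<lambda>s. of_bool (s = t)) (permutation_action g v) = 0" if "t \<notin> {1..n + 1}" for t
    proof -
      have "linext ((\<lambda>s. of_bool (s = t)) \<circ> g) v = linext (\<lambda>_. 0) v"
        by (rule linext_cong[OF v(1)]) (use that permutes_in_image[OF g] in auto)
      then show ?thesis by (simp add: linext_permutation_action) (simp add: linext_def)
    qed
    then have "Poly_Mapping.keys (permutation_action g v) \<subseteq> {1..n + 1}"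
      by (rule keys_linext)
    then show ?thesis
      using v(2) by (simp add: reflection_module_carrier_iff linext_permutation_action o_def)
  qed
  then show "permutation_action g \<in> linear_maps (reflection_module n) (reflection_module n)"
    by (auto simp: linear_maps_def intro!: linext_eqI simp: linext_permutation_action)
next
  show "permutation_action \<one>\<^bsub>sym_group (n + 1)\<^esub> x = x" for x
    by (rule linext_eqI) (simp add: linext_permutation_action sym_group_def)
  show "permutation_action (g \<otimes>\<^bsub>sym_group (n + 1)\<^esub> h) x = permutation_action g (permutation_action h x)" for g h x
    by (rule linext_eqI) (simp add: linext_permutation_action sym_group_def o_assoc)
qed

section \<open>The isomorphism\<close>

lemma symdias_pairing_expand:
  assumes "1 \<le> n" "u \<in> carrier (comps SymDias n)"
  shows "symdias_pairing n u F = (\<Sum>m = 1..n. symdias_pairing n u (\<lambda>p. of_bool (p = m)) * F m)"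
proof -
  have "symdias_pairing n u F = symdias_pairing n u (\<lambda>p. \<Sum>m = 1..n. F m * of_bool (p = m))"
    using assms by (intro SymDias.L_cong) (auto simp: of_bool_def if_distrib cong: if_cong)
  also have "\<dots> = (\<Sum>m = 1..n. F m * symdias_pairing n u (\<lambda>p. of_bool (p = m)))"
    by (simp only: SymDias.L_test_sum SymDias.L_test_scale)
  finally show ?thesis by (simp add: mult.commute)
qed

lemma symdias_pairing_surj:
  assumes n: "1 \<le> n"
  obtains u where "u \<in> carrier (comps SymDias n)" "\<And>F. symdias_pairing n u F = (\<Sum>m = 1..n. a m * F m)"
proof -
  interpret D: functional_family "comps Dias n" dias_pairing by (rule Dias.functional_family[OF n])
  let ?f = "\<lambda>m. a m \<odot>\<^bsub>comps Dias n\<^esub> dias_tree (normal_tree n m)"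
  define X where "X = finsum (comps Dias n) ?f {1..n}"
  have tree: "dias_tree (normal_tree n m) \<in> carrier (comps Dias n)" if "m \<in> {1..n}" for m
    using that by (intro dias_tree_closed size1_normal_tree)
  then have f: "?f m \<in> carrier (comps Dias n)" if "m \<in> {1..n}" for m
    using that by (simp add: D.smult_closed)
  have X: "X \<in> carrier (comps Dias n)"
    unfolding X_def using f by (intro D.M.finsum_closed) blast
  have LX: "dias_pairing X F = (\<Sum>m = 1..n. a m * F m)" for F
  proof -
    have "dias_pairing X F = (\<Sum>m = 1..n. dias_pairing (?f m) F)"
      unfolding X_def by (rule D.L_finsum[OF _ f]) simp_all
    also have "\<dots> = (\<Sum>m = 1..n. a m * F m)"
      by (rule sum.cong[OF refl]) (simp only: D.L_smult[OF tree] dias_pairing_tree head_normal_tree)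
    finally show ?thesis .
  qed
  show thesis
    by (rule that[of "pure_tensor Dias n X id"])
      (simp_all add: pure_tensor_closed n X symdias_pairing_pure_tensor permutes_id LX)
qed

theorem theorem5p2:
  fixes n :: nat
  assumes "n \<ge> 1"
    and "dias_anticyclic \<tau>"
    and "perm_anticyclic \<tau> \<rho>"
  shows "isomorphic_reps (sym_group (n + 1)) (comps Perm n) (\<rho> n)
           (reflection_module n) permutation_action"
proof -
  note n = assms(1) and \<tau> = assms(2)
  interpret S: functional_family "comps SymDias n" "symdias_pairing n"
    by (rule SymDias.functional_family[OF n])
  have Perm_eq: "comps Perm n = S.Q"
    by (simp add: Perm_def quot_operad_def quot_nsoperad_def perm_ideal_eq[OF n])
  have proj_eq: "quot_proj SymDias perm_ideal n u = annihilated (comps SymDias n) (symdias_pairing n) +>\<^bsub>comps SymDias n\<^esub> u" for u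
    by (simp add: quot_proj_def perm_ideal_eq[OF n])
  let ?proj = "quot_proj SymDias perm_ideal n"
  \<comment> \<open>The coordinates of a coset are its pairings with the indicator functions of the variables.\<close>
  define \<phi> where "\<phi> Y = reflection_vector n (\<lambda>m. on_cosets (symdias_pairing n) Y (\<lambda>p. of_bool (p = m)))" for Y
  have proj_cases: "\<exists>u\<in>carrier (comps SymDias n). Y = ?proj u" if "Y \<in> carrier (comps Perm n)" for Y
    using that by (auto simp: Perm_eq proj_eq elim: S.quot_cases)
  have proj_closed: "?proj u \<in> carrier (comps Perm n)" if "u \<in> carrier (comps SymDias n)" for u
    using that by (simp only: Perm_eq proj_eq S.quot_closed)
  have coset: "on_cosets (symdias_pairing n) (?proj u) = symdias_pairing n u"
    if "u \<in> carrier (comps SymDias n)" for u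
    using that by (simp only: proj_eq S.on_cosets_coset)
  have linext_\<phi>: "linext F (\<phi> (?proj u)) = reduced_pairing n u F" if "u \<in> carrier (comps SymDias n)" for u F
    unfolding \<phi>_def coset[OF that] linext_reflection_vector reduced_pairing_def
    by (rule symdias_pairing_expand[OF n that, symmetric])
  have rep: "linear_rep (sym_group (n + 1)) (comps Perm n) (\<rho> n)"
    using assms(3) anticyclic_operad.rep[OF _ n] by (auto simp: perm_anticyclic_def)
  have \<phi>_linear: "\<phi> \<in> linear_maps (comps Perm n) (reflection_module n)"
    unfolding linear_maps_def
  proof (intro CollectI conjI ballI allI funcsetI)
    show "\<phi> Y \<in> carrier (reflection_module n)" for Y
      by (simp add: \<phi>_def reflection_module_carrier)
    fix Y assume "Y \<in> carrier (comps Perm n)"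
    then obtain u where u: "u \<in> carrier (comps SymDias n)" "Y = ?proj u" using proj_cases by blast
    have "a \<odot>\<^bsub>comps Perm n\<^esub> Y = ?proj (a \<odot>\<^bsub>comps SymDias n\<^esub> u)" for a
      using S.quot_smult[OF u(1)] by (simp only: Perm_eq proj_eq u(2))
    then show "\<phi> (a \<odot>\<^bsub>comps Perm n\<^esub> Y) = a \<odot>\<^bsub>reflection_module n\<^esub> \<phi> Y" for a
      using u by (intro linext_eqI) (simp add: linext_\<phi> reduced_pairing_def S.L_smult S.smult_closed)
    fix Z assume "Z \<in> carrier (comps Perm n)"
    then obtain v where v: "v \<in> carrier (comps SymDias n)" "Z = ?proj v" using proj_cases by blast
    have "Y \<oplus>\<^bsub>comps Perm n\<^esub> Z = ?proj (u \<oplus>\<^bsub>comps SymDias n\<^esub> v)"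
      using S.quot_add[OF u(1) v(1)] by (simp only: Perm_eq proj_eq u(2) v(2))
    then show "\<phi> (Y \<oplus>\<^bsub>comps Perm n\<^esub> Z) = \<phi> Y \<oplus>\<^bsub>reflection_module n\<^esub> \<phi> Z"
      using u v by (intro linext_eqI) (simp add: linext_\<phi> reduced_pairing_def S.L_add)
  qed
  have inj: "inj_on \<phi> (carrier (comps Perm n))"
  proof (rule inj_onI)
    fix Y Z assume Y: "Y \<in> carrier (comps Perm n)" and Z: "Z \<in> carrier (comps Perm n)" and eq: "\<phi> Y = \<phi> Z"
    obtain u v where uv: "u \<in> carrier (comps SymDias n)" "Y = ?proj u"
      "v \<in> carrier (comps SymDias n)" "Z = ?proj v"
      using proj_cases[OF Y] proj_cases[OF Z] by blast
    have "symdias_pairing n u F = symdias_pairing n v F" for F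
    proof -
      \<comment> \<open>The value at \<open>n + 1\<close> is not seen by the pairing, so it may be set to zero.\<close>
      have restrict: "symdias_pairing n w F = reduced_pairing n w (F(n + 1 := 0))"
        if "w \<in> carrier (comps SymDias n)" for w
        unfolding reduced_pairing_def by (rule SymDias.L_cong[OF n that]) auto
      show ?thesis
        using uv eq by (simp add: restrict flip: linext_\<phi>)
    qed
    then show "Y = Z"
      using S.quot_eq_iff[of Y Z] Y Z uv coset by (simp add: Perm_eq fun_eq_iff)
  qed
  have surj: "v \<in> \<phi> ` carrier (comps Perm n)" if v_in: "v \<in> carrier (reflection_module n)" for v
  proof -
    obtain a where v: "v = reflection_vector n a"
      using v_in by (auto simp: reflection_module_carrier)
    obtain u where u: "u \<in> carrier (comps SymDias n)" "\<And>F. symdias_pairing n u F = (\<Sum>m = 1..n. a m * F m)"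
      using symdias_pairing_surj[OF n] by blast
    have "v = \<phi> (?proj u)"
      by (rule linext_eqI) (simp add: v linext_reflection_vector linext_\<phi>[OF u(1)] reduced_pairing_def u(2))
    then show ?thesis using proj_closed[OF u(1)] by blast
  qed
  have equivariant: "\<phi> (\<rho> n g Y) = permutation_action g (\<phi> Y)"
    if g: "g permutes {1..n + 1}" and Y: "Y \<in> carrier (comps Perm n)" for g Y
  proof -
    obtain u where u: "u \<in> carrier (comps SymDias n)" "Y = ?proj u" using proj_cases[OF Y] by blast
    have "\<rho> n g Y = ?proj (symmetrization_action Dias \<tau> n g u)"
      using assms(3) g n u by (simp add: perm_anticyclic_def anticyclic_morphism_def)
    then show ?thesis
      using u g symmetrization_action_closed[OF \<tau> n u(1)]
      by (intro linext_eqI)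
        (simp add: linext_permutation_action linext_\<phi> reduced_pairing_action[OF \<tau> n])
  qed
  have "bij_betw \<phi> (carrier (comps Perm n)) (carrier (reflection_module n))"
    using inj surj \<phi>_linear unfolding bij_betw_def linear_maps_def by blast
  then show ?thesis
    unfolding isomorphic_reps_def
    using rep linear_rep_reflection_module \<phi>_linear equivariant
    by (auto simp: sym_group_def)
qed

end
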